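(* Let $d,m\in\mathbb{N}$, $A\in\mathbb{R}^{d\times d}$ and $B\in\mathbb{R}^{d\times m}$. Assume that all eigenvalues of $A$ lie in the closed unit disk, and that every eigenvalue $\lambda$ of $A$ with $|\lambda|=1$ has equal algebraic and geometric multiplicities. Assume the pair $(A,B)$ is stabilizable. Let $(w_t)_{t\in\mathbb{N}_0}$ be a sequence of mutually independent $\mathbb{R}^d$-valued random vectors (not necessarily identically distributed) with $\mathsf{E}[w_t]=0$, $\mathsf{E}[w_tw_t^{\mathrm T}]=Q_t$, and $\sup_{t\in\mathbb{N}_0}\mathsf{E}[\|w_t\|^4]<\infty$. Consider the system $$x_{t+1}=Ax_t+Bu_t+w_t,\qquad x_0=x,\quad t\in\mathbb{N}_0 .$$ Then there exist $R>0$, an integer $k\le d$, and a deterministic $k$-history-dependent policy $(\pi_t)_{t\in\mathbb{N}_0}$, i.e. measurable maps $\pi_t:\mathbb{R}^{d\times k}\to\mathbb{R}^m$ with $\|\pi_t(\cdot)\|\le R$ for every $t$, such that, for the closed-loop system $$x_{t+1}=Ax_t+B\pi_t(x_t,x_{t-1},\ldots,x_{t-k+1})+w_t,\qquad x_0=x,\quad t\in\mathbb{N}_0,$$ (with the convention $x_{-k+1}=\cdots=x_{-1}=x_0$): (P1) for every fixed $x\in\mathbb{R}^d$ the process $(x_t)_{t\in\mathbb{N}_0}$ satisfies $\sup_{t\in\mathbb{N}_0}\mathsf{E}_x[\|x_t\|^2]<\infty$; and (P2) in the absence of noise (i.e. with $w_t\equiv 0$) the origin is asymptotically stable for the closed-loop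 system.
   Context: $\|\cdot\|$ denotes the Euclidean norm. $\mathsf{E}_x$ denotes expectation given the initial condition $x_0=x$ (deterministic). Stabilizable means there is a matrix $K$ with $A+BK$ having all eigenvalues in the open unit disk. *)

theory Defs
  imports "HOL-Probability.Probability" "HOL-Computational_Algebra.Polynomial"
begin

definition cmat :: "real^'n^'n \<Rightarrow> complex^'n^'n" where
  "cmat A = (\<chi> i j. complex_of_real (A $ i $ j))"

definition charpoly :: "real^'n^'n \<Rightarrow> complex poly" where
  "charpoly A = det (\<chi> i j. (if i = j then [:0, 1:] else 0) - [: cmat A $ i $ j :])"

definition is_eigenvalue :: "real^'n^'n \<Rightarrow> complex \<Rightarrow> bool" where
  "is_eigenvalue A l \<longleftrightarrow> (\<exists>v. v \<noteq> 0 \<and> cmat A *v v = l *s v)"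

definition alg_mult :: "real^'n^'n \<Rightarrow> complex \<Rightarrow> nat" where
  "alg_mult A l = order l (charpoly A)"

definition geom_mult :: "real^'n^'n \<Rightarrow> complex \<Rightarrow> nat" where
  "geom_mult A l = vec.dim {v :: complex^'n. cmat A *v v = l *s v}"

definition stabilizable :: "real^'n^'n \<Rightarrow> real^'m^'n \<Rightarrow> bool" where
  "stabilizable A B \<longleftrightarrow>
     (\<exists>K :: real^'n^'m. \<forall>l. is_eigenvalue (A + B ** K) l \<longrightarrow> cmod l < 1)"

text \<open>History of the closed-loop system under a k-history-dependent policy pol and
  noise realisation w: cl_hist A B k pol w x t i = x_(t-i) for i \<le> t and = x_0 for i > t
  (convention x_(-j) = x_0).  The policy at time t is applied to the restriction of the
  history to indices {..<k}, i.e. to (x_t, x_(t-1), ..., x_(t-k+1)).\<close>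
primrec cl_hist ::
  "real^'d^'d \<Rightarrow> real^'m^'d \<Rightarrow> nat \<Rightarrow> (nat \<Rightarrow> (nat \<Rightarrow> real^'d) \<Rightarrow> real^'m)
    \<Rightarrow> (nat \<Rightarrow> real^'d) \<Rightarrow> real^'d \<Rightarrow> nat \<Rightarrow> nat \<Rightarrow> real^'d" where
  "cl_hist A B k pol w x 0 = (\<lambda>i. x)"
| "cl_hist A B k pol w x (Suc t) =
     (\<lambda>i. if i = 0
          then A *v cl_hist A B k pol w x t 0
               + B *v pol t (restrict (cl_hist A B k pol w x t) {..<k}) + w t
          else cl_hist A B k pol w x t (i - 1))"

definition cl_state ::
  "real^'d^'d \<Rightarrow> real^'m^'d \<Rightarrow> nat \<Rightarrow> (nat \<Rightarrow> (nat \<Rightarrow> real^'d) \<Rightarrow> real^'m)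
    \<Rightarrow> (nat \<Rightarrow> real^'d) \<Rightarrow> real^'d \<Rightarrow> nat \<Rightarrow> real^'d" where
  "cl_state A B k pol w x t = cl_hist A B k pol w x t 0"

definition asymp_stable_origin :: "('a::real_normed_vector \<Rightarrow> nat \<Rightarrow> 'a) \<Rightarrow> bool" where
  "asymp_stable_origin traj \<longleftrightarrow>
     (\<forall>e>0. \<exists>\<delta>>0. \<forall>x. norm x < \<delta> \<longrightarrow> (\<forall>t. norm (traj x t) < e)) \<and>
     (\<exists>\<eta>>0. \<forall>x. norm x < \<eta> \<longrightarrow> (traj x \<longlonglongrightarrow> 0))"

end

theory Submission
  imports Defs "HOL-Computational_Algebra.Fundamental_Theorem_Algebra"
begin

text \<open>
  The spectral hypotheses make \<open>A\<close> power bounded, so \<open>lim\<^sub>n sup\<^sub>m norm (A\<^sup>n\<^sup>+\<^sup>m x)\<close> is a seminorm \<open>p\<close> for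
  which \<open>A\<close> is isometric and whose null space consists of the points attracted to the origin by
  \<open>A\<close>. Stabilizability implies that modulo this null space every point is reachable in \<open>d\<close> steps.
  Hence at each multiple of \<open>d\<close> one can choose, as bounded functions of the current state \<open>y\<close>, the
  next \<open>d\<close> controls in such a way that without noise \<open>p y\<close> drops to \<open>max (p y - r) 0\<close>; the
  controller remembers \<open>y\<close> through the history. With noise, \<open>max (p y - r) 0\<close> is dominated by a
  Lindley recursion \<open>V' = max 0 (V + \<xi> - r)\<close>, which has bounded second moments if \<open>r\<close> is large
  compared with the fourth moments of \<open>\<xi>\<close>. The full state is controlled by \<open>p\<close> and a norm \<open>q\<close> with
  \<open>q (A x) \<le> \<theta> * q x + C * p x\<close>, \<open>\<theta> < 1\<close>.
\<close>

section \<open>Characteristic matrices and semisimple eigenvalues\<close>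

lemma prod_dvd_det_of_columns:
  fixes M :: "'a::comm_ring_1^'n^'n"
  assumes "\<And>i j. q j dvd M $ i $ j"
  shows "(\<Prod>j\<in>UNIV. q j) dvd det M"
proof -
  have "(\<Prod>j\<in>UNIV. q j) dvd of_int (sign p) * (\<Prod>i\<in>UNIV. M $ i $ p i)"
    if "p permutes UNIV" for p
  proof -
    have "(\<Prod>j\<in>UNIV. q j) = (\<Prod>i\<in>UNIV. q (p i))"
      using prod.permute[OF that, of q] by (simp add: o_def)
    also have "\<dots> dvd (\<Prod>i\<in>UNIV. M $ i $ p i)"
      using assms by (intro prod_dvd_prod) auto
    finally show ?thesis by (rule dvd_mult)
  qed
  then show ?thesis
    unfolding det_def by (intro dvd_sum) auto
qed

lemma poly_det:
  fixes M :: "'a::comm_ring_1 poly^'n^'n"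
  shows "poly (det M) x = det (\<chi> i j. poly (M $ i $ j) x)"
  by (simp add: det_def poly_sum poly_prod)

lemma coeff_prod_of_degree_le_1:
  fixes q :: "'i \<Rightarrow> 'a::comm_ring_1 poly"
  assumes "finite S" "\<And>i. i \<in> S \<Longrightarrow> degree (q i) \<le> 1"
  shows "coeff (prod q S) (card S) = (\<Prod>i\<in>S. coeff (q i) 1)"
  using assms
proof (induction S rule: finite_induct)
  case (insert i S)
  have "degree (prod q S) \<le> card S"
    using degree_prod_sum_le[OF insert.hyps(1), of q] insert.prems
      sum_bounded_above[of S "degree \<circ> q" 1] by (simp add: o_def)
  moreover obtain a b where "q i = [:a, b:]"
    using degree1_coeffs[of "q i"] degree_eq_zeroE[of "q i"] insert.prems[of i]
    by (metis insertI1 le_less less_one pCons_0_0)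
  ultimately show ?case
    using insert by (simp add: coeff_eq_0)
qed simp

lemma coeff_det_of_degree_le_1:
  fixes M :: "'a::comm_ring_1 poly^'n^'n"
  assumes "\<And>i j. degree (M $ i $ j) \<le> 1"
  shows "coeff (det M) CARD('n) = det (\<chi> i j. coeff (M $ i $ j) 1)"
proof -
  have "coeff (of_int s * (\<Prod>i\<in>UNIV. M $ i $ p i)) CARD('n)
      = of_int s * (\<Prod>i\<in>UNIV. coeff (M $ i $ p i) 1)" for s p
    using coeff_prod_of_degree_le_1[of "UNIV :: 'n set" "\<lambda>i. M $ i $ p i"] assms
    by (simp add: of_int_poly)
  then show ?thesis
    by (simp add: det_def coeff_sum)
qed

definition char_matrix :: "'a::comm_ring_1^'n^'n \<Rightarrow> 'a poly^'n^'n" where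
  "char_matrix T = (\<chi> i j. (if i = j then [:0, 1:] else 0) - [:T $ i $ j:])"

lemma det_char_matrix_nonzero: "det (char_matrix T) \<noteq> 0"
proof -
  have "coeff (det (char_matrix T)) CARD('n) = det (mat 1 :: 'a^'n^'n)"
    for T :: "'a::comm_ring_1^'n^'n"
    by (subst coeff_det_of_degree_le_1)
       (auto simp: char_matrix_def mat_def intro!: arg_cong[where f = det] simp: vec_eq_iff)
  then show ?thesis
    by (metis coeff_0 det_I zero_neq_one)
qed

lemma char_matrix_mult_nth:
  "(char_matrix T ** P) $ i $ j = [:0, 1:] * P $ i $ j - (\<Sum>k\<in>UNIV. [:T $ i $ k:] * P $ k $ j)"
  by (simp add: char_matrix_def matrix_matrix_mult_def left_diff_distrib sum_subtractf
      if_distrib[of "\<lambda>a. a * _"] cong: if_cong)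

lemma poly_char_matrix_mult_nth:
  "poly ((char_matrix T ** P) $ i $ j) x
    = x * poly (P $ i $ j) x - (T *v (\<chi> k. poly (P $ k $ j) x)) $ i"
  by (simp add: char_matrix_mult_nth poly_sum matrix_vector_mult_def)

lemma sum_le_order_det_char_matrix:
  fixes T :: "'a::field^'n^'n"
  assumes dvd: "\<And>i j. [:-l, 1:] ^ e j dvd (char_matrix T ** P) $ i $ j"
    and regular: "poly (det P) l \<noteq> 0"
  shows "(\<Sum>j\<in>UNIV. e j) \<le> order l (det (char_matrix T))"
proof -
  have "det P \<noteq> 0" using regular by auto
  then have nonzero: "det (char_matrix T) * det P \<noteq> 0"
    using det_char_matrix_nonzero by simp
  have "[:-l, 1:] ^ (\<Sum>j\<in>UNIV. e j) dvd det (char_matrix T) * det P"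
    using prod_dvd_det_of_columns[where q = "\<lambda>j. [:-l, 1:] ^ e j", OF dvd]
    by (simp add: power_sum det_mul)
  then have "(\<Sum>j\<in>UNIV. e j) \<le> order l (det (char_matrix T) * det P)"
    using nonzero order_divides by blast
  also have "\<dots> = order l (det (char_matrix T))"
    using nonzero regular by (simp add: order_mult order_0I)
  finally show ?thesis .
qed

lemma det_of_spanning_columns_nonzero:
  fixes f :: "'n::finite \<Rightarrow> 'a::field^'n"
  assumes "vec.span (range f) = UNIV"
  shows "det (\<chi> i j. f j $ i) \<noteq> 0"
proof -
  have "columns (\<chi> i j. f j $ i) = range f"
    by (auto simp: columns_def column_def vec_lambda_eta)
  then show ?thesis
    using assms
    by (simp flip: invertible_det_nz
        add: invertible_right_inverse matrix_right_invertible_span_columns)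
qed

lemma indexed_basis_extending_subspace_basis:
  fixes S :: "('a::field^'n) set"
  assumes "u \<in> S" "u \<noteq> 0"
  obtains f :: "'n \<Rightarrow> 'a^'n" and I where
    "vec.span (range f) = UNIV" "f ` I \<subseteq> S" "card I = vec.dim S" "u \<in> f ` I"
proof -
  obtain C where C: "{u} \<subseteq> C" "C \<subseteq> S" "vec.independent C" "S \<subseteq> vec.span C"
    using vec.maximal_independent_subset_extend[of "{u}" S] assms by auto
  define E where "E = vec.extend_basis C"
  have E: "C \<subseteq> E" "vec.independent E" "vec.span E = UNIV"
    using vec.extend_basis_superset[OF C(3)] vec.independent_extend_basis[OF C(3)]
      vec.span_extend_basis[OF C(3)] by (auto simp: E_def)
  have "card E = CARD('n)"
    using vec.basis_card_eq_dim[of E UNIV] E by (simp add: card_cart_basis)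
  moreover have "finite E"
    using E(2) vec.finiteI_independent by blast
  ultimately obtain f :: "'n \<Rightarrow> 'a^'n" where f: "bij_betw f UNIV E"
    using finite_same_card_bij[of "UNIV :: 'n set" E] by auto
  then have range: "range f = E" and "inj f"
    by (auto simp: bij_betw_def)
  then have image: "f ` (f -` C) = C"
    using E(1) by auto
  then have "card (f -` C) = card C"
    using \<open>inj f\<close> card_image[of f "f -` C"] by (simp add: inj_on_def)
  then have "card (f -` C) = vec.dim S"
    using vec.basis_card_eq_dim[OF C(2,4,3)] by simp
  then show thesis
    using that[of f "f -` C"] range E(3) image C(1,2) by (simp only: insert_subset simp_thms)
qed

definition eigenspace :: "'a::field^'n^'n \<Rightarrow> 'a \<Rightarrow> ('a^'n) set" where
  "eigenspace T l = {v. T *v v = l *s v}"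

lemma mem_eigenspace_iff: "v \<in> eigenspace T l \<longleftrightarrow> T *v v = l *s v"
  by (simp add: eigenspace_def)

lemma linear_factor_dvd_char_matrix_mult:
  assumes "\<And>k. P $ k $ j = [:f $ k:]" "f \<in> eigenspace T l"
  shows "[:-l, 1:] dvd (char_matrix T ** P) $ i $ j"
proof -
  have "(\<chi> k. poly (P $ k $ j) l) = f"
    by (simp add: assms(1) vec_eq_iff)
  then have "poly ((char_matrix T ** P) $ i $ j) l = 0"
    using assms(2) by (simp add: poly_char_matrix_mult_nth assms(1) mem_eigenspace_iff)
  then show ?thesis by (simp add: poly_eq_0_iff_dvd)
qed

lemma square_factor_dvd_char_matrix_mult:
  fixes T :: "'a::field_char_0^'n^'n"
  assumes P: "\<And>k. P $ k $ j = [:u $ k - l * v $ k, v $ k:]"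
    and u: "u \<in> eigenspace T l" and v: "T *v v = u + l *s v"
  shows "[:-l, 1:]\<^sup>2 dvd (char_matrix T ** P) $ i $ j"
proof -
  have column: "(\<chi> k. poly (P $ k $ j) x) = u - l *s v + x *s v" for x
    by (simp add: P vec_eq_iff)
  have "poly ((char_matrix T ** P) $ i $ j) x = poly ([:-l, 1:]\<^sup>2 * [:v $ i:]) x" for x
    unfolding poly_char_matrix_mult_nth column using u v
    by (simp add: P mem_eigenspace_iff matrix_vector_right_distrib matrix_vector_mult_diff_distrib
        vector_scalar_commute power2_eq_square algebra_simps)
  then have "(char_matrix T ** P) $ i $ j = [:-l, 1:]\<^sup>2 * [:v $ i:]"
    by (simp add: poly_eq_poly_eq_iff[symmetric] fun_eq_iff del: poly_mult)
  then show ?thesis by (simp only: dvd_triv_left)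
qed

text \<open>Replace the column \<open>u\<close> by \<open>(X - l) v + u\<close>. Multiplication by \<open>X - T\<close> turns it into
  \<open>(X - l)\<^sup>2 v\<close>, which provides one more factor \<open>X - l\<close> than the eigenvectors do.\<close>

lemma card_eigenvectors_less_order_det_char_matrix:
  fixes T :: "'a::field_char_0^'n^'n" and f :: "'n \<Rightarrow> 'a^'n"
  assumes spanning: "vec.span (range f) = UNIV" and eigenvectors: "f ` I \<subseteq> eigenspace T l"
    and u: "u \<in> f ` I" and v: "T *v v = u + l *s v"
  shows "card I < order l (det (char_matrix T))"
proof -
  obtain i0 where i0: "i0 \<in> I" "f i0 = u" using u by blast
  define P :: "'a poly^'n^'n" where
    "P = (\<chi> i j. if j = i0 then [:u $ i - l * v $ i, v $ i:] else [:f j $ i:])"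
  define e where "e j = (if j = i0 then 2 else if j \<in> I then 1 else 0 :: nat)" for j
  have "[:-l, 1:] ^ e j dvd (char_matrix T ** P) $ i $ j" for i j
  proof -
    consider "j = i0" | "j \<noteq> i0" "j \<in> I" | "j \<notin> I" using i0(1) by blast
    then show ?thesis
    proof cases
      case 1
      have "[:-l, 1:]\<^sup>2 dvd (char_matrix T ** P) $ i $ i0"
        using eigenvectors u
        by (intro square_factor_dvd_char_matrix_mult[OF _ _ v]) (auto simp: P_def)
      then show ?thesis using 1 by (simp only: e_def if_True simp_thms)
    next
      case 2
      then have "[:-l, 1:] dvd (char_matrix T ** P) $ i $ j"
        using eigenvectors
        by (intro linear_factor_dvd_char_matrix_mult[of P j "f j"]) (auto simp: P_def)
      then show ?thesis using 2 by (simp add: e_def)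
    qed (use i0(1) in \<open>auto simp: e_def\<close>)
  qed
  moreover have "poly (det P) l \<noteq> 0"
  proof -
    have "poly (det P) l = det (\<chi> i j. f j $ i)"
      unfolding poly_det by (rule arg_cong[where f = det]) (auto simp: vec_eq_iff P_def i0(2))
    then show ?thesis using det_of_spanning_columns_nonzero[OF spanning] by simp
  qed
  ultimately have "(\<Sum>j\<in>UNIV. e j) \<le> order l (det (char_matrix T))"
    by (rule sum_le_order_det_char_matrix)
  moreover have "e j = (if j \<in> I then 1 else 0) + (if j = i0 then 1 else 0)" for j
    using i0(1) by (simp add: e_def)
  ultimately show ?thesis by (simp add: sum.distrib sum.If_cases)
qed

lemma generalized_eigenvector_in_eigenspace:
  fixes T :: "'a::field_char_0^'n^'n"
  assumes multiplicity: "order l (det (char_matrix T)) = vec.dim (eigenspace T l)"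
    and generalized: "T *v v - l *s v \<in> eigenspace T l"
  shows "v \<in> eigenspace T l"
proof (rule ccontr)
  assume "v \<notin> eigenspace T l"
  then have "T *v v - l *s v \<noteq> 0" by (simp add: mem_eigenspace_iff)
  then obtain f :: "'n \<Rightarrow> 'a^'n" and I where "vec.span (range f) = UNIV" "f ` I \<subseteq> eigenspace T l"
      and card: "card I = vec.dim (eigenspace T l)" and "T *v v - l *s v \<in> f ` I"
    using indexed_basis_extending_subspace_basis[OF generalized] by blast
  then have "card I < order l (det (char_matrix T))"
    by (intro card_eigenvectors_less_order_det_char_matrix[where u = "T *v v - l *s v" and v = v])
      simp_all
  then show False
    using card multiplicity by simp
qed

section \<open>Invariant subspaces\<close>

lemma (in finite_dimensional_vector_space) subspace_image_eq_of_inj_on: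
  assumes lin: "Vector_Spaces.linear scale scale f" and S: "subspace S"
    and "f ` S \<subseteq> S" "inj_on f S"
  shows "f ` S = S"
proof -
  interpret finite_dimensional_vector_space_pair_1 scale Basis scale ..
  interpret f: Vector_Spaces.linear scale scale f by (fact lin)
  show ?thesis
  proof (rule subspace_dim_equal)
    show "subspace (f ` S)" by (rule f.subspace_image[OF S])
    show "dim S \<le> dim (f ` S)"
      using dim_image_eq[OF lin, of S] assms S by (simp add: span_eq_iff[THEN iffD2])
  qed fact+
qed

text \<open>Since \<open>f\<close> is injective on its range, it maps \<open>G \<inter> range f\<close> onto itself.\<close>

lemma (in finite_dimensional_vector_space) mem_subspace_of_image_mem:
  assumes lin: "Vector_Spaces.linear scale scale f" and G: "subspace G" "f ` G \<subseteq> G"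
    and ker: "\<And>v. f v = 0 \<Longrightarrow> v \<in> G" and ker2: "\<And>v. f (f v) = 0 \<Longrightarrow> f v = 0"
    and v: "f v \<in> G"
  shows "v \<in> G"
proof -
  interpret f: Vector_Spaces.linear scale scale f by (fact lin)
  define H where "H = G \<inter> range f"
  have "f ` H = H"
  proof (rule subspace_image_eq_of_inj_on[OF lin])
    show "subspace H"
      unfolding H_def by (intro subspace_inter G f.subspace_image subspace_UNIV)
    show "f ` H \<subseteq> H"
      using G(2) by (auto simp: H_def)
    show "inj_on f H"
    proof (rule inj_onI)
      fix x y assume "x \<in> H" "y \<in> H" "f x = f y"
      then obtain a b where "x = f a" "y = f b" by (auto simp: H_def)
      then show "x = y"
        using ker2[of "a - b"] \<open>f x = f y\<close> by (simp add: f.diff)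
    qed
  qed
  moreover have "f v \<in> H"
    using v by (simp add: H_def)
  ultimately obtain g where g: "g \<in> G" "f g = f v"
    by (metis H_def IntD1 imageE)
  then have "v - g \<in> G"
    by (intro ker) (simp add: f.diff)
  then show ?thesis
    using subspace_add[OF G(1) _ g(1), of "v - g"] by simp
qed

lemma nontrivial_linear_relation_exists:
  fixes b :: "nat \<Rightarrow> 'a::field^'n"
  obtains c i0 where "(\<Sum>i\<le>CARD('n). c i *s b i) = 0" "i0 \<le> CARD('n)" "c i0 \<noteq> 0"
proof (cases "inj_on b {..CARD('n)}")
  case True
  have "vec.dependent (b ` {..CARD('n)})"
  proof (rule ccontr)
    assume "vec.independent (b ` {..CARD('n)})"
    then have "card (b ` {..CARD('n)}) \<le> CARD('n)"
      using vec.independent_card_le_dim[of "b ` {..CARD('n)}" UNIV] by (simp add: card_cart_basis)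
    then show False using True by (simp add: card_image)
  qed
  then obtain c i0 where "(\<Sum>x\<in>b ` {..CARD('n)}. c x *s x) = 0" "i0 \<le> CARD('n)" "c (b i0) \<noteq> 0"
    by (auto simp: vec.dependent_finite)
  then show thesis
    using that[of "c \<circ> b" i0] by (simp add: sum.reindex[OF True])
next
  case False
  then obtain i j where ij: "i \<le> CARD('n)" "j \<le> CARD('n)" "i \<noteq> j" "b i = b j"
    by (auto simp: inj_on_def)
  define c where "c k = (if k = i then 1 else 0) - (if k = j then 1 else 0 :: 'a)" for k
  have "(\<Sum>k\<le>CARD('n). c k *s b k) = b i - b j"
    using ij by (simp add: c_def vec.scale_left_diff_distrib sum_subtractf
        if_distrib[of "\<lambda>a. a *s _"] cong: if_cong)
  then show thesis
    using that[of c i] ij by (simp add: c_def)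
qed

definition poly_action :: "'a::field^'n^'n \<Rightarrow> 'a poly \<Rightarrow> 'a^'n \<Rightarrow> 'a^'n" where
  "poly_action T p x = fold_coeffs (\<lambda>a v. a *s x + T *v v) p 0"

lemma poly_action_0 [simp]: "poly_action T 0 x = 0"
  by (simp add: poly_action_def)

lemma poly_action_pCons [simp]: "poly_action T (pCons a p) x = a *s x + T *v poly_action T p x"
  by (cases "a = 0 \<and> p = 0") (auto simp: poly_action_def)

lemma poly_action_add: "poly_action T (p + q) x = poly_action T p x + poly_action T q x"
  by (induction p q rule: poly_induct2)
     (auto simp: vec.scale_left_distrib matrix_vector_right_distrib)

lemma poly_action_smult: "poly_action T (smult c p) x = c *s poly_action T p x"
  by (induction p) (auto simp: vec.scale_right_distrib vector_scalar_commute vector_smult_assoc)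

lemma poly_action_sum: "poly_action T (sum p I) x = (\<Sum>i\<in>I. poly_action T (p i) x)"
  by (induction I rule: infinite_finite_induct) (auto simp: poly_action_add)

lemma poly_action_linear_factor:
  "poly_action T ([:-l, 1:] * p) x = T *v poly_action T p x - l *s poly_action T p x"
proof -
  have "[:-l, 1:] * p = smult (-l) p + pCons 0 p" by simp
  then show ?thesis
    by (simp only: poly_action_add poly_action_smult) (simp add: vec.scale_minus_left)
qed

lemma annihilating_poly_exists: "\<exists>p. p \<noteq> 0 \<and> poly_action T p x = 0"
  for T :: "'a::field^'n^'n"
proof -
  obtain c i0 where c: "(\<Sum>i\<le>CARD('n). c i *s poly_action T (monom 1 i) x) = 0"
      "i0 \<le> CARD('n)" "c i0 \<noteq> 0"
    by (rule nontrivial_linear_relation_exists)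
  define p where "p = (\<Sum>i\<le>CARD('n). smult (c i) (monom 1 i))"
  have "coeff p i0 = c i0"
    using c(2) by (simp add: p_def coeff_sum if_distrib cong: if_cong)
  moreover have "poly_action T p x = 0"
    using c(1) by (simp add: p_def poly_action_sum poly_action_smult)
  ultimately show ?thesis using c(3) by (metis coeff_0)
qed

text \<open>Factor a polynomial of minimal degree that takes a vector outside of \<open>G\<close> into \<open>G\<close>.\<close>

lemma eigenvector_modulo_subspace_exists:
  fixes T :: "complex^'n^'n"
  assumes G: "vec.subspace G" "G \<noteq> UNIV"
  obtains l v where "v \<notin> G" "T *v v - l *s v \<in> G"
proof -
  obtain x where "x \<notin> G" using G(2) by blast
  obtain p0 where p0: "p0 \<noteq> 0 \<and> poly_action T p0 x \<in> G"
    using annihilating_poly_exists[of T x] vec.subspace_0[OF G(1)] by metis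
  then obtain p where p: "p \<noteq> 0" "poly_action T p x \<in> G"
      and minimal: "\<And>q. q \<noteq> 0 \<Longrightarrow> poly_action T q x \<in> G \<Longrightarrow> degree p \<le> degree q"
    using ex_has_least_nat[of "\<lambda>p. p \<noteq> 0 \<and> poly_action T p x \<in> G" p0 degree] by blast
  have "degree p \<noteq> 0"
  proof
    assume "degree p = 0"
    then obtain a where "p = [:a:]" by (rule degree_eq_zeroE)
    then have "a \<noteq> 0" "a *s x \<in> G" using p by auto
    then have "inverse a *s (a *s x) \<in> G" using vec.subspace_scale[OF G(1)] by blast
    then show False using \<open>a \<noteq> 0\<close> \<open>x \<notin> G\<close> by (simp add: vector_smult_assoc)
  qed
  then obtain l where "poly p l = 0"
    by (metis fundamental_theorem_of_algebra constant_degree)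
  then obtain q where q: "p = [:-l, 1:] * q"
    by (meson poly_eq_0_iff_dvd dvdE)
  have "q \<noteq> 0" using q p(1) by auto
  then have "degree p = Suc (degree q)"
    unfolding q by (subst degree_mult_eq) auto
  then have "poly_action T q x \<notin> G"
    using minimal[OF \<open>q \<noteq> 0\<close>] by auto
  moreover have "T *v poly_action T q x - l *s poly_action T q x \<in> G"
    using p(2) unfolding q poly_action_linear_factor .
  ultimately show thesis by (rule that)
qed

section \<open>Bounded and decaying orbits\<close>

lemma geometric_recursion_le:
  fixes a :: "nat \<Rightarrow> real"
  assumes "0 \<le> \<theta>" "\<And>n. a (Suc n) \<le> \<theta> * a n + (1 - \<theta>) * C"
  shows "a n \<le> C + \<theta> ^ n * (a 0 - C)"
proof (induction n)
  case (Suc n)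
  have "a (Suc n) \<le> \<theta> * (C + \<theta> ^ n * (a 0 - C)) + (1 - \<theta>) * C"
    using assms(2)[of n] mult_left_mono[OF Suc assms(1)] by linarith
  then show ?case by (simp add: algebra_simps)
qed simp

lemma bounded_of_contracting_recursion:
  fixes a :: "nat \<Rightarrow> real"
  assumes \<theta>: "0 \<le> \<theta>" "\<theta> < 1" and rec: "\<And>n. a (Suc n) \<le> \<theta> * a n + C"
  shows "a n \<le> max (a 0) (C / (1 - \<theta>))"
proof (induction n)
  case (Suc n)
  let ?m = "max (a 0) (C / (1 - \<theta>))"
  have "a (Suc n) \<le> \<theta> * ?m + (1 - \<theta>) * (C / (1 - \<theta>))"
    using rec[of n] mult_left_mono[OF Suc \<theta>(1)] \<theta>(2) by simp
  also have "\<dots> \<le> \<theta> * ?m + (1 - \<theta>) * ?m"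
    using \<theta>(2) by (intro add_left_mono mult_left_mono) auto
  finally show ?case by (simp add: algebra_simps)
qed simp

lemma tendsto_0_of_contracting_recursion:
  fixes a e :: "nat \<Rightarrow> real"
  assumes \<theta>: "0 \<le> \<theta>" "\<theta> < 1" and nonneg: "\<And>n. 0 \<le> a n"
    and rec: "\<And>n. a (Suc n) \<le> \<theta> * a n + e n" and e: "e \<longlonglongrightarrow> 0"
  shows "a \<longlonglongrightarrow> 0"
proof (rule order_tendstoI)
  fix \<epsilon> :: real assume "\<epsilon> > 0"
  then have "\<forall>\<^sub>F n in sequentially. e n < (1 - \<theta>) * (\<epsilon> / 2)"
    using \<theta>(2) by (intro order_tendstoD(2)[OF e]) simp
  then obtain N where N: "\<And>n. e (N + n) < (1 - \<theta>) * (\<epsilon> / 2)"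
    by (metis eventually_sequentially le_add1)
  have "a (N + Suc n) \<le> \<theta> * a (N + n) + (1 - \<theta>) * (\<epsilon> / 2)" for n
    using rec[of "N + n"] N[of n] by simp
  then have "a (N + n) \<le> \<epsilon> / 2 + \<theta> ^ n * (a N - \<epsilon> / 2)" for n
    using geometric_recursion_le[OF \<theta>(1), of "\<lambda>n. a (N + n)"] by simp
  moreover have "(\<lambda>n. \<epsilon> / 2 + \<theta> ^ n * (a N - \<epsilon> / 2)) \<longlonglongrightarrow> \<epsilon> / 2 + 0 * (a N - \<epsilon> / 2)"
    by (intro tendsto_intros LIMSEQ_power_zero) (use \<theta> in simp)
  then have "\<forall>\<^sub>F n in sequentially. \<epsilon> / 2 + \<theta> ^ n * (a N - \<epsilon> / 2) < \<epsilon>"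
    by (rule order_tendstoD(2)) (use \<open>\<epsilon> > 0\<close> in simp)
  ultimately have "\<forall>\<^sub>F n in sequentially. a (n + N) < \<epsilon>"
    by (auto elim!: eventually_mono simp: add.commute intro: order_le_less_trans)
  then show "\<forall>\<^sub>F n in sequentially. a n < \<epsilon>"
    by (rule eventually_sequentially_seg[THEN iffD1])
qed (use order_less_le_trans[OF _ nonneg] in simp)

lemma norm_vector_scalar_mult: "norm (c *s v) = cmod c * norm v" for v :: "complex^'n"
  by (simp add: norm_vec_def norm_mult L2_set_right_distrib)

lemma funpow_matrix_vector:
  fixes T :: "'a::field^'n^'n"
  shows "((*v) T ^^ n) (v + w) = ((*v) T ^^ n) v + ((*v) T ^^ n) w"
    and "((*v) T ^^ n) (c *s v) = c *s ((*v) T ^^ n) v"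
    and "((*v) T ^^ n) 0 = 0"
  by (induction n) (auto simp: matrix_vector_right_distrib vector_scalar_commute)

lemma norm_funpow_Suc_le:
  fixes T :: "complex^'n^'n"
  shows "norm (((*v) T ^^ Suc n) v)
    \<le> cmod l * norm (((*v) T ^^ n) v) + norm (((*v) T ^^ n) (T *v v - l *s v))"
proof -
  have "((*v) T ^^ Suc n) v = ((*v) T ^^ n) (l *s v + (T *v v - l *s v))"
    by (simp add: funpow_swap1)
  also have "\<dots> = l *s ((*v) T ^^ n) v + ((*v) T ^^ n) (T *v v - l *s v)"
    by (simp only: funpow_matrix_vector)
  finally show ?thesis
    by (metis norm_triangle_ineq norm_vector_scalar_mult)
qed

lemma mat_mult_vector: "mat c *v v = c *s v" for v :: "'a::comm_ring_1^'n"
  by (simp add: vec_eq_iff mat_def matrix_vector_mult_def if_distrib[of "\<lambda>a. a * _"] cong: if_cong)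

lemma invariant_subspace_eq_UNIV:
  fixes T :: "complex^'n^'n"
  assumes G: "vec.subspace G" and invariant: "\<And>v. v \<in> G \<Longrightarrow> T *v v \<in> G"
    and inside: "\<And>l v. cmod l < 1 \<Longrightarrow> T *v v - l *s v \<in> G \<Longrightarrow> v \<in> G"
    and eigen: "\<And>l. 1 \<le> cmod l \<Longrightarrow> eigenspace T l \<subseteq> G"
    and semisimple: "\<And>l v. 1 \<le> cmod l \<Longrightarrow> T *v v - l *s v \<in> eigenspace T l \<Longrightarrow> v \<in> eigenspace T l"
  shows "G = UNIV"
proof (rule ccontr)
  assume "G \<noteq> UNIV"
  with G obtain l v where v: "v \<notin> G" "T *v v - l *s v \<in> G"
    by (rule eigenvector_modulo_subspace_exists)
  have "1 \<le> cmod l"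
    using inside v by force
  have shift: "(T - mat l) *v x = T *v x - l *s x" for x
    by (simp add: matrix_vector_mult_diff_rdistrib mat_mult_vector)
  have "v \<in> G"
  proof (rule vec.mem_subspace_of_image_mem[of "(*v) (T - mat l)"])
    show "(*v) (T - mat l) ` G \<subseteq> G"
      using invariant vec.subspace_diff[OF G _ vec.subspace_scale[OF G]] by (auto simp: shift)
    show "x \<in> G" if "(T - mat l) *v x = 0" for x
      using eigen[OF \<open>1 \<le> cmod l\<close>] that by (auto simp: shift mem_eigenspace_iff)
    show "(T - mat l) *v x = 0" if "(T - mat l) *v ((T - mat l) *v x) = 0" for x
      using semisimple[OF \<open>1 \<le> cmod l\<close>, of x] that by (simp add: shift mem_eigenspace_iff)
  qed (use G v in \<open>simp_all add: shift\<close>)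
  with v(1) show False ..
qed

lemma subspace_bounded_orbits: "vec.subspace {v. bounded (range (\<lambda>n. ((*v) T ^^ n) v))}"
  for T :: "complex^'n^'n"
proof (rule vec.subspaceI, unfold mem_Collect_eq)
  show "bounded (range (\<lambda>n. ((*v) T ^^ n) 0))"
    by (simp add: funpow_matrix_vector)
  show "bounded (range (\<lambda>n. ((*v) T ^^ n) (v + w)))"
    if "bounded (range (\<lambda>n. ((*v) T ^^ n) v))" "bounded (range (\<lambda>n. ((*v) T ^^ n) w))" for v w
    using that by (simp add: funpow_matrix_vector bounded_plus_comp)
  fix c v assume "bounded (range (\<lambda>n. ((*v) T ^^ n) v))"
  then obtain C where "\<And>n. norm (((*v) T ^^ n) v) \<le> C"
    by (auto simp: bounded_iff)
  then have "norm (((*v) T ^^ n) (c *s v)) \<le> cmod c * C" for n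
    by (simp add: funpow_matrix_vector norm_vector_scalar_mult mult_left_mono)
  then show "bounded (range (\<lambda>n. ((*v) T ^^ n) (c *s v)))"
    by (auto simp: bounded_iff)
qed

lemma norm_funpow_eigenvector_le:
  fixes T :: "complex^'n^'n"
  assumes "v \<in> eigenspace T l" "cmod l = 1"
  shows "norm (((*v) T ^^ n) v) \<le> norm v"
proof (induction n)
  case (Suc n)
  then show ?case
    using norm_funpow_Suc_le[of n T v l] assms
    by (simp add: mem_eigenspace_iff funpow_matrix_vector)
qed simp

lemma bounded_orbit_of_contracting_factor:
  fixes T :: "complex^'n^'n"
  assumes l: "cmod l < 1" and bounded: "bounded (range (\<lambda>n. ((*v) T ^^ n) (T *v v - l *s v)))"
  shows "bounded (range (\<lambda>n. ((*v) T ^^ n) v))"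
proof -
  obtain C where C: "\<And>n. norm (((*v) T ^^ n) (T *v v - l *s v)) \<le> C"
    using bounded by (auto simp: bounded_iff)
  have "norm (((*v) T ^^ Suc n) v) \<le> cmod l * norm (((*v) T ^^ n) v) + C" for n
    using norm_funpow_Suc_le[of n T v l] C[of n] by linarith
  then have "norm (((*v) T ^^ n) v) \<le> max (norm (((*v) T ^^ 0) v)) (C / (1 - cmod l))" for n
    by (rule bounded_of_contracting_recursion[OF norm_ge_zero l])
  then show ?thesis by (auto simp: bounded_iff)
qed

lemma bounded_orbits_of_semisimple_unit_eigenvalues:
  fixes T :: "complex^'n^'n"
  assumes outside: "\<And>l. 1 < cmod l \<Longrightarrow> eigenspace T l \<subseteq> {0}"
    and semisimple: "\<And>l v. cmod l = 1 \<Longrightarrow> T *v v - l *s v \<in> eigenspace T l \<Longrightarrow> v \<in> eigenspace T l"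
  shows "bounded (range (\<lambda>n. ((*v) T ^^ n) v))"
proof -
  define G where "G = {v. bounded (range (\<lambda>n. ((*v) T ^^ n) v))}"
  have "G = UNIV"
  proof (rule invariant_subspace_eq_UNIV)
    show subspace: "vec.subspace G"
      unfolding G_def by (rule subspace_bounded_orbits)
    show "T *v v \<in> G" if "v \<in> G" for v
      using that unfolding G_def mem_Collect_eq
      by (rule bounded_subset) (auto simp: funpow_swap1 intro: range_eqI[of _ _ "Suc _"])
    show "v \<in> G" if l: "cmod l < 1" and v: "T *v v - l *s v \<in> G" for l v
      using bounded_orbit_of_contracting_factor[OF l] v by (simp add: G_def)
    show "eigenspace T l \<subseteq> G" if "1 \<le> cmod l" for l
    proof (cases "cmod l = 1")
      case True
      then show ?thesis
        using norm_funpow_eigenvector_le by (fastforce simp: G_def bounded_iff)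
    next
      case False
      then show ?thesis
        using outside[of l] that vec.subspace_0[OF subspace] by auto
    qed
    show "v \<in> eigenspace T l" if "1 \<le> cmod l" "T *v v - l *s v \<in> eigenspace T l" for l v
    proof (cases "cmod l = 1")
      case False
      then have "T *v v - l *s v = 0" using outside[of l] that by auto
      then show ?thesis by (simp add: mem_eigenspace_iff)
    qed (use semisimple that in blast)
  qed
  then show ?thesis by (auto simp: G_def)
qed

lemma subspace_orbits_tendsto_0: "vec.subspace {v. (\<lambda>n. ((*v) T ^^ n) v) \<longlonglongrightarrow> 0}"
  for T :: "complex^'n^'n"
proof (rule vec.subspaceI, unfold mem_Collect_eq)
  show "(\<lambda>n. ((*v) T ^^ n) 0) \<longlonglongrightarrow> 0"
    by (simp add: funpow_matrix_vector)
  show "(\<lambda>n. ((*v) T ^^ n) (v + w)) \<longlonglongrightarrow> 0"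
    if "(\<lambda>n. ((*v) T ^^ n) v) \<longlonglongrightarrow> 0" "(\<lambda>n. ((*v) T ^^ n) w) \<longlonglongrightarrow> 0" for v w
    using tendsto_add[OF that] by (simp add: funpow_matrix_vector)
  fix c v assume "(\<lambda>n. ((*v) T ^^ n) v) \<longlonglongrightarrow> 0"
  then have "(\<lambda>n. norm (c *s ((*v) T ^^ n) v)) \<longlonglongrightarrow> 0"
    unfolding norm_vector_scalar_mult by (intro tendsto_mult_right_zero tendsto_norm_zero)
  then show "(\<lambda>n. ((*v) T ^^ n) (c *s v)) \<longlonglongrightarrow> 0"
    by (simp add: funpow_matrix_vector tendsto_norm_zero_cancel)
qed

lemma orbit_tendsto_0_of_contracting_factor:
  fixes T :: "complex^'n^'n"
  assumes l: "cmod l < 1" and tendsto: "(\<lambda>n. ((*v) T ^^ n) (T *v v - l *s v)) \<longlonglongrightarrow> 0"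
  shows "(\<lambda>n. ((*v) T ^^ n) v) \<longlonglongrightarrow> 0"
proof -
  have "(\<lambda>n. norm (((*v) T ^^ n) v)) \<longlonglongrightarrow> 0"
    using tendsto_norm_zero[OF tendsto]
    by (rule tendsto_0_of_contracting_recursion[where a = "\<lambda>n. norm (((*v) T ^^ n) v)",
          OF norm_ge_zero l norm_ge_zero norm_funpow_Suc_le])
  then show ?thesis by (rule tendsto_norm_zero_cancel)
qed

lemma orbits_tendsto_0_of_eigenvalues_inside:
  fixes T :: "complex^'n^'n"
  assumes eigen: "\<And>l. 1 \<le> cmod l \<Longrightarrow> eigenspace T l \<subseteq> {0}"
  shows "(\<lambda>n. ((*v) T ^^ n) v) \<longlonglongrightarrow> 0"
proof -
  define G where "G = {v. (\<lambda>n. ((*v) T ^^ n) v) \<longlonglongrightarrow> 0}"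
  have "G = UNIV"
  proof (rule invariant_subspace_eq_UNIV)
    show subspace: "vec.subspace G"
      unfolding G_def by (rule subspace_orbits_tendsto_0)
    show "T *v v \<in> G" if "v \<in> G" for v
      using LIMSEQ_Suc[of "\<lambda>n. ((*v) T ^^ n) v" 0] that by (simp add: G_def funpow_swap1)
    show "v \<in> G" if l: "cmod l < 1" and v: "T *v v - l *s v \<in> G" for l v
      using orbit_tendsto_0_of_contracting_factor[OF l] v by (simp add: G_def)
    show "eigenspace T l \<subseteq> G" if "1 \<le> cmod l" for l
      using eigen[OF that] vec.subspace_0[OF subspace] by blast
    show "v \<in> eigenspace T l" if "1 \<le> cmod l" "T *v v - l *s v \<in> eigenspace T l" for l v
    proof -
      have "T *v v - l *s v = 0" using eigen that by blast
      then show ?thesis by (simp add: mem_eigenspace_iff)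
    qed
  qed
  then show ?thesis by (auto simp: G_def)
qed

definition cvec :: "real^'n \<Rightarrow> complex^'n" where
  "cvec x = (\<chi> i. complex_of_real (x $ i))"

lemma norm_cvec: "norm (cvec x) = norm x"
  by (simp add: norm_vec_def cvec_def)

lemma cmat_mult_cvec: "cmat A *v cvec x = cvec (A *v x)"
  by (simp add: vec_eq_iff cvec_def cmat_def matrix_vector_mult_def)

lemma funpow_cmat_cvec: "((*v) (cmat A) ^^ n) (cvec x) = cvec (((*v) A ^^ n) x)"
  by (induction n) (auto simp: cmat_mult_cvec)

lemma is_eigenvalue_iff_eigenspace: "is_eigenvalue A l \<longleftrightarrow> \<not> eigenspace (cmat A) l \<subseteq> {0}"
  by (auto simp: is_eigenvalue_def eigenspace_def)

lemma alg_mult_eq_order: "alg_mult A l = order l (det (char_matrix (cmat A)))"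
  by (simp add: alg_mult_def charpoly_def char_matrix_def)

lemma geom_mult_eq_dim_eigenspace: "geom_mult A l = vec.dim (eigenspace (cmat A) l)"
  by (simp add: geom_mult_def eigenspace_def)

proposition bounded_orbits:
  fixes A :: "real^'n^'n"
  assumes disk: "\<And>l. is_eigenvalue A l \<Longrightarrow> cmod l \<le> 1"
    and unit: "\<And>l. is_eigenvalue A l \<Longrightarrow> cmod l = 1 \<Longrightarrow> alg_mult A l = geom_mult A l"
  shows "bounded (range (\<lambda>n. ((*v) A ^^ n) x))"
proof -
  have "bounded (range (\<lambda>n. ((*v) (cmat A) ^^ n) (cvec x)))"
  proof (rule bounded_orbits_of_semisimple_unit_eigenvalues)
    show "eigenspace (cmat A) l \<subseteq> {0}" if "1 < cmod l" for l
      using disk[of l] that by (force simp: is_eigenvalue_iff_eigenspace)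
    show "v \<in> eigenspace (cmat A) l"
      if l: "cmod l = 1" and v: "cmat A *v v - l *s v \<in> eigenspace (cmat A) l" for l v
    proof (cases "is_eigenvalue A l")
      case True
      then show ?thesis
        using unit[OF True l] v generalized_eigenvector_in_eigenspace
        unfolding alg_mult_eq_order geom_mult_eq_dim_eigenspace by blast
    next
      case False
      then show ?thesis
      proof -
        have "cmat A *v v - l *s v = 0"
          using False v by (auto simp: is_eigenvalue_iff_eigenspace)
        then show ?thesis by (simp add: mem_eigenspace_iff)
      qed
    qed
  qed
  then show ?thesis
    by (simp add: bounded_iff funpow_cmat_cvec norm_cvec)
qed

proposition orbits_tendsto_0:
  fixes A :: "real^'n^'n"
  assumes "\<And>l. is_eigenvalue A l \<Longrightarrow> cmod l < 1"
  shows "(\<lambda>n. ((*v) A ^^ n) x) \<longlonglongrightarrow> 0"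
proof -
  have "(\<lambda>n. ((*v) (cmat A) ^^ n) (cvec x)) \<longlonglongrightarrow> 0"
    using assms
    by (intro orbits_tendsto_0_of_eigenvalues_inside) (force simp: is_eigenvalue_iff_eigenspace)
  then have "(\<lambda>n. norm (((*v) A ^^ n) x)) \<longlonglongrightarrow> 0"
    using tendsto_norm_zero by (force simp: funpow_cmat_cvec norm_cvec)
  then show ?thesis
    by (rule tendsto_norm_zero_cancel)
qed

section \<open>Seminorms on Euclidean spaces\<close>

locale seminorm =
  fixes p :: "'a::real_vector \<Rightarrow> real"
  assumes triangle: "p (x + y) \<le> p x + p y"
    and scale: "p (c *\<^sub>R x) = \<bar>c\<bar> * p x"
begin

lemma zero [simp]: "p 0 = 0"
  using scale[of 0 0] by simp

lemma minus [simp]: "p (- x) = p x"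
  using scale[of "-1" x] by simp

lemma minus_commute: "p (x - y) = p (y - x)"
  using minus[of "x - y"] by simp

lemma nonneg [simp]: "0 \<le> p x"
  using triangle[of x "- x"] by simp

lemma triangle_sum: "p (\<Sum>i\<in>I. g i) \<le> (\<Sum>i\<in>I. p (g i))"
  by (induction I rule: infinite_finite_induct) (auto intro: order_trans[OF triangle])

lemma abs_diff_le: "\<bar>p x - p y\<bar> \<le> p (x - y)"
  using triangle[of "x - y" y] triangle[of "y - x" x] by (simp add: minus_commute[of y x])

lemma eq_of_null_diff: "p (x - y) = 0 \<Longrightarrow> p x = p y"
  using abs_diff_le[of x y] by simp

lemma null_add: "p x = 0 \<Longrightarrow> p y = 0 \<Longrightarrow> p (x + y) = 0"
  using triangle[of x y] nonneg[of "x + y"] by linarith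

lemma subspace_null: "subspace {x. p x = 0}"
  by (rule subspaceI) (auto simp: scale null_add)

end

lemma seminormI:
  assumes triangle: "\<And>x y. p (x + y) \<le> p x + p y"
    and scale_le: "\<And>c x. p (c *\<^sub>R x) \<le> \<bar>c\<bar> * p x"
  shows "seminorm p"
proof
  have "0 \<le> p 0" using triangle[of 0 0] by simp
  show "p (c *\<^sub>R x) = \<bar>c\<bar> * p x" for c x
  proof (cases "c = 0")
    case False
    have "\<bar>c\<bar> * p x \<le> \<bar>c\<bar> * (\<bar>1 / c\<bar> * p (c *\<^sub>R x))"
      using False scale_le[of "1 / c" "c *\<^sub>R x"] by (intro mult_left_mono) auto
    then show ?thesis using False scale_le[of c x] by simp
  qed (use scale_le[of 0 x] \<open>0 \<le> p 0\<close> in simp)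
qed (rule triangle)

lemma seminorm_norm: "seminorm norm"
  by unfold_locales (auto simp: norm_triangle_ineq)

lemma seminorm_sum:
  assumes "\<And>i. i \<in> I \<Longrightarrow> seminorm (p i)"
  shows "seminorm (\<lambda>x. \<Sum>i\<in>I. p i x)"
proof
  show "(\<Sum>i\<in>I. p i (x + y)) \<le> (\<Sum>i\<in>I. p i x) + (\<Sum>i\<in>I. p i y)" for x y
    unfolding sum.distrib[symmetric] using seminorm.triangle[OF assms] by (intro sum_mono)
qed (simp add: seminorm.scale[OF assms] sum_distrib_left)

lemma seminorm_compose_linear:
  assumes "seminorm p" "linear g"
  shows "seminorm (\<lambda>x. p (g x))"
  using assms
  by unfold_locales (simp_all add: seminorm.triangle seminorm.scale linear_add linear_scale)

lemma linear_projection_exists: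
  assumes S: "subspace S"
  obtains P where "linear P" "\<And>x. x \<in> S \<Longrightarrow> P x = 0" "\<And>x. x - P x \<in> S"
proof -
  obtain C where C: "C \<subseteq> S" "independent C" "S \<subseteq> span C"
    by (rule maximal_independent_subset[of S])
  obtain P where P: "linear P" "\<And>x. x \<in> extend_basis C \<Longrightarrow> P x = (if x \<in> C then 0 else x)"
    using linear_independent_extend[OF independent_extend_basis[OF C(2)],
        of "\<lambda>x. if x \<in> C then 0 else x"]
    by blast
  have "P x = 0" if "x \<in> S" for x
  proof (rule linear_eq_0_on_span[OF P(1)])
    show "x \<in> span C" using C(3) that by blast
    show "P b = 0" if "b \<in> C" for b
      using P(2)[of b] extend_basis_superset[OF C(2)] that by auto
  qed
  moreover have "x - P x \<in> S" for x
  proof -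
    have "x \<in> span (extend_basis C)"
      by (simp add: span_extend_basis[OF C(2)])
    then show ?thesis
    proof (induction rule: span_induct)
      case base
      show ?case
        using linear_subspace_vimage[OF linear_compose_sub[OF linear_ident P(1)] S]
        by (simp add: vimage_def)
    next
      case (step x)
      then show ?case using P(2)[of x] C(1) subspace_0[OF S] by auto
    qed
  qed
  ultimately show thesis using that P(1) by blast
qed

locale euclidean_seminorm = seminorm p for p :: "'a::euclidean_space \<Rightarrow> real"
begin

lemma le_norm: "p x \<le> (\<Sum>b\<in>Basis. p b) * norm x"
proof -
  have "p x = p (\<Sum>b\<in>Basis. (x \<bullet> b) *\<^sub>R b)"
    by (simp add: euclidean_representation)
  also have "\<dots> \<le> (\<Sum>b\<in>Basis. \<bar>x \<bullet> b\<bar> * p b)"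
    by (rule order_trans[OF triangle_sum]) (simp add: scale)
  also have "\<dots> \<le> (\<Sum>b\<in>Basis. norm x * p b)"
    by (intro sum_mono mult_right_mono Basis_le_norm) auto
  finally show ?thesis by (simp add: sum_distrib_left mult.commute)
qed

lemma continuous_on: "continuous_on S p"
proof (rule continuous_on_subset[OF lipschitz_on_continuous_on])
  show "(\<Sum>b\<in>Basis. p b)-lipschitz_on UNIV p"
    by (rule lipschitz_onI)
      (auto simp: dist_norm intro: order_trans[OF abs_diff_le le_norm] sum_nonneg)
qed auto

lemma norm_le_of_definite_on:
  assumes S: "subspace S" and definite: "\<And>z. z \<in> S \<Longrightarrow> p z = 0 \<Longrightarrow> z = 0"
  obtains C where "0 \<le> C" "\<And>z. z \<in> S \<Longrightarrow> norm z \<le> C * p z"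
proof (cases "S \<subseteq> {0}")
  case True
  then show thesis using that[of 0] by auto
next
  case False
  have normalized: "(1 / norm z) *\<^sub>R z \<in> sphere 0 1 \<inter> S" if "z \<in> S" "z \<noteq> 0" for z
    using that S by (auto intro: subspace_scale)
  then have nonempty: "sphere 0 1 \<inter> S \<noteq> {}" using False by blast
  have "compact (sphere 0 1 \<inter> S)"
    by (intro compact_Int_closed compact_sphere closed_subspace S)
  then obtain m where m: "m \<in> sphere 0 1 \<inter> S" "\<And>z. z \<in> sphere 0 1 \<inter> S \<Longrightarrow> p m \<le> p z"
    using continuous_attains_inf[OF _ nonempty continuous_on] by blast
  have "p m > 0"
    using m(1) definite[of m] nonneg[of m] by (auto simp: less_le)
  have "norm z \<le> (1 / p m) * p z" if "z \<in> S" for z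
  proof (cases "z = 0")
    case nonzero: False
    have "p m \<le> p ((1 / norm z) *\<^sub>R z)" by (rule m(2)[OF normalized[OF that nonzero]])
    then show ?thesis using nonzero \<open>p m > 0\<close> by (simp add: scale field_simps)
  qed simp
  then show thesis using that[of "1 / p m"] \<open>p m > 0\<close> by simp
qed

lemma projection_along_null_exists:
  obtains P C where "linear P" "\<And>x. p (x - P x) = 0" "0 \<le> C" "\<And>x. norm (P x) \<le> C * p x"
proof -
  obtain P where P: "linear P" "\<And>x. p x = 0 \<Longrightarrow> P x = 0" "\<And>x. p (x - P x) = 0"
    by (rule linear_projection_exists[OF subspace_null]) simp
  have p_P: "p (P x) = p x" for x
    using eq_of_null_diff[OF P(3)] by simp
  have "P x = 0" if "p (P x) = 0" for x
    using P(2)[of x] that by (simp add: p_P)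
  then obtain C where C: "0 \<le> C" "\<And>z. z \<in> range P \<Longrightarrow> norm z \<le> C * p z"
    using norm_le_of_definite_on[OF linear_subspace_image[OF P(1) subspace_UNIV]] by blast
  then have "norm (P x) \<le> C * p x" for x
    by (metis p_P rangeI)
  with P(1,3) C(1) show thesis by (rule that)
qed

lemma mem_subspace_of_approximations:
  assumes S: "subspace S" and null: "{x. p x = 0} \<subseteq> S"
    and approx: "\<And>e. 0 < e \<Longrightarrow> \<exists>y\<in>S. p (x - y) < e"
  shows "x \<in> S"
proof -
  obtain P C where P: "linear P" "\<And>x. p (x - P x) = 0" "0 \<le> C" "\<And>x. norm (P x) \<le> C * p x"
    by (rule projection_along_null_exists) blast
  have residue: "z - P z \<in> S" for z
    using null P(2) by blast
  have "P x \<in> closure S"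
    unfolding closure_approachable
  proof (intro allI impI)
    fix e :: real assume "0 < e"
    then obtain y where y: "y \<in> S" "p (x - y) < e / (C + 1)"
      using approx[of "e / (C + 1)"] P(3) by auto
    have "P y \<in> S"
      using subspace_diff[OF S y(1) residue[of y]] by simp
    moreover have "dist (P y) (P x) \<le> (C + 1) * p (x - y)"
      using P(4)[of "x - y"] nonneg[of "x - y"]
      by (simp add: dist_norm norm_minus_commute linear_diff[OF P(1)] distrib_right del: nonneg)
    then have "dist (P y) (P x) < e"
      using y(2) P(3) by (simp add: field_simps)
    ultimately show "\<exists>y\<in>S. dist y (P x) < e" by blast
  qed
  then have "P x \<in> S"
    using closed_subspace[OF S] by simp
  then show ?thesis
    using subspace_add[OF S _ residue[of x]] by force
qed

text \<open>On the image of \<open>S\<close> under the projection along the null space, \<open>h\<close> induces an injective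
  endomorphism.\<close>

lemma isometry_onto_subspace_modulo_null:
  assumes h: "linear h" "\<And>x. p (h x) = p x" and S: "subspace S" "{x. p x = 0} \<subseteq> S" "h ` S \<subseteq> S"
    and y: "y \<in> S"
  obtains z where "z \<in> S" "p (y - h z) = 0"
proof -
  obtain P C where P: "linear P" "\<And>x. p (x - P x) = 0" "0 \<le> C" "\<And>x. norm (P x) \<le> C * p x"
    by (rule projection_along_null_exists) blast
  have p_P: "p (P x) = p x" for x
    using eq_of_null_diff[OF P(2)] by simp
  have P_null: "P x = 0" if "p x = 0" for x
    using P(4)[of x] that by simp
  have P_P: "P (P x) = P x" for x
    using P_null[OF P(2), of x] by (simp add: linear_diff[OF P(1)])
  have PS: "P ` S \<subseteq> S"
    using subspace_diff[OF S(1), of x "x - P x" for x] S(2) P(2) by fastforce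
  have "(P \<circ> h) ` (P ` S) = P ` S"
  proof (rule eucl.subspace_image_eq_of_inj_on)
    show "linear (P \<circ> h)" by (rule linear_compose[OF h(1) P(1)])
    show "subspace (P ` S)" by (rule linear_subspace_image[OF P(1) S(1)])
    show "(P \<circ> h) ` (P ` S) \<subseteq> P ` S" using PS S(3) by auto
    show "inj_on (P \<circ> h) (P ` S)"
    proof (rule inj_onI, clarify)
      fix a b assume "(P \<circ> h) (P a) = (P \<circ> h) (P b)"
      then have "P (h (P a - P b)) = 0"
        by (simp add: linear_diff[OF P(1)] linear_diff[OF h(1)])
      then have "p (P a - P b) = 0"
        using p_P[of "h (P a - P b)"] h(2) by simp
      then show "P a = P b"
        using P_null[of "P a - P b"] by (simp add: linear_diff[OF P(1)] P_P)
    qed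
  qed
  then obtain z where z: "z \<in> S" "P y = P (h z)"
    using y PS by (auto simp: image_iff set_eq_iff)
  then have "p (y - h z) = 0"
    using p_P[of "y - h z"] by (simp add: linear_diff[OF P(1)])
  then show thesis using that z(1) by blast
qed

end

section \<open>The limit seminorm of a power bounded map\<close>

lemma linear_funpow: "linear f \<Longrightarrow> linear (f ^^ n)" for f :: "'a::real_vector \<Rightarrow> 'a"
  by (induction n) (auto simp: linear_id[unfolded id_def] id_def intro: linear_compose)

locale power_bounded_map =
  fixes f :: "'a::euclidean_space \<Rightarrow> 'a" and L :: real
  assumes linear: "linear f"
    and norm_funpow_le: "norm ((f ^^ n) x) \<le> L * norm x"

lemma power_bounded_map_of_bounded_orbits:
  fixes f :: "'a::euclidean_space \<Rightarrow> 'a"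
  assumes "linear f" "\<And>x. bounded (range (\<lambda>n. (f ^^ n) x))"
  obtains L where "power_bounded_map f L"
proof -
  have "\<forall>x. \<exists>C. \<forall>n. norm ((f ^^ n) x) \<le> C"
    using assms(2) by (simp add: bounded_iff)
  then obtain C where C: "\<And>x n. norm ((f ^^ n) x) \<le> C x"
    by metis
  have "norm ((f ^^ n) x) \<le> (\<Sum>b\<in>Basis. C b) * norm x" for n x
  proof -
    interpret euclidean_seminorm "\<lambda>x. norm ((f ^^ n) x)"
      unfolding euclidean_seminorm_def
      by (rule seminorm_compose_linear[OF seminorm_norm linear_funpow[OF assms(1)]])
    have "(\<Sum>b\<in>Basis. norm ((f ^^ n) b)) * norm x \<le> (\<Sum>b\<in>Basis. C b) * norm x"
      by (intro mult_right_mono sum_mono C) auto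
    then show ?thesis using le_norm[of x] by linarith
  qed
  with assms(1) have "power_bounded_map f (\<Sum>b\<in>Basis. C b)"
    by (rule power_bounded_map.intro)
  then show thesis by (rule that)
qed

context power_bounded_map
begin

lemma linear_iter: "linear (f ^^ n)"
  by (rule linear_funpow[OF linear])

lemma iter_step: "(f ^^ n) (f x) = f ((f ^^ n) x)"
  by (rule funpow_swap1[symmetric])

lemma L_ge_1: "1 \<le> L"
proof -
  obtain b :: 'a where "b \<in> Basis" using nonempty_Basis by blast
  then show ?thesis using norm_funpow_le[of 0 b] by simp
qed

definition orbit_norm :: "'a \<Rightarrow> real" where
  "orbit_norm x = (SUP n. norm ((f ^^ n) x))"

lemma norm_iter_le_orbit_norm: "norm ((f ^^ n) x) \<le> orbit_norm x"
  unfolding orbit_norm_def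
  by (intro cSUP_upper bdd_aboveI2[of _ _ "L * norm x"] norm_funpow_le) auto

lemma orbit_norm_leI: "(\<And>n. norm ((f ^^ n) x) \<le> c) \<Longrightarrow> orbit_norm x \<le> c"
  unfolding orbit_norm_def by (intro cSUP_least) auto

lemma norm_le_orbit_norm: "norm x \<le> orbit_norm x"
  using norm_iter_le_orbit_norm[of 0 x] by simp

lemma orbit_norm_le: "orbit_norm x \<le> L * norm x"
  by (rule orbit_norm_leI[OF norm_funpow_le])

lemma orbit_norm_step_le: "orbit_norm (f x) \<le> orbit_norm x"
  using norm_iter_le_orbit_norm[of "Suc _" x] by (intro orbit_norm_leI) (simp add: iter_step)

sublocale orbit: seminorm orbit_norm
proof (rule seminormI)
  show "orbit_norm (x + y) \<le> orbit_norm x + orbit_norm y" for x y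
    by (rule orbit_norm_leI)
       (simp add: linear_add[OF linear_iter] norm_triangle_mono norm_iter_le_orbit_norm)
  show "orbit_norm (c *\<^sub>R x) \<le> \<bar>c\<bar> * orbit_norm x" for c x
    by (rule orbit_norm_leI)
       (simp add: linear_scale[OF linear_iter] norm_iter_le_orbit_norm mult_left_mono)
qed

definition limit_norm :: "'a \<Rightarrow> real" where
  "limit_norm x = lim (\<lambda>n. orbit_norm ((f ^^ n) x))"

lemma decseq_orbit_norm: "decseq (\<lambda>n. orbit_norm ((f ^^ n) x))"
  by (rule decseq_SucI) (simp add: orbit_norm_step_le)

lemma orbit_norm_tendsto_limit_norm: "(\<lambda>n. orbit_norm ((f ^^ n) x)) \<longlonglongrightarrow> limit_norm x"
proof -
  obtain l where "(\<lambda>n. orbit_norm ((f ^^ n) x)) \<longlonglongrightarrow> l"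
    using decseq_convergent[OF decseq_orbit_norm, of 0 x] orbit.nonneg by blast
  then show ?thesis unfolding limit_norm_def by (simp add: limI)
qed

sublocale limit: euclidean_seminorm limit_norm
  unfolding euclidean_seminorm_def
proof (rule seminormI)
  note tendsto = orbit_norm_tendsto_limit_norm
  show "limit_norm (x + y) \<le> limit_norm x + limit_norm y" for x y
    by (rule LIMSEQ_le[OF tendsto tendsto_add[OF tendsto tendsto]])
       (auto simp: linear_add[OF linear_iter] orbit.triangle)
  show "limit_norm (c *\<^sub>R x) \<le> \<bar>c\<bar> * limit_norm x" for c x
    by (rule LIMSEQ_le[OF tendsto tendsto_mult_left[OF tendsto]])
       (auto simp: linear_scale[OF linear_iter] orbit.scale)
qed

lemma limit_norm_le: "limit_norm x \<le> L * norm x"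
  using decseq_ge[OF decseq_orbit_norm orbit_norm_tendsto_limit_norm, of x 0] orbit_norm_le[of x]
  by simp

lemma limit_norm_step [simp]: "limit_norm (f x) = limit_norm x"
proof (rule LIMSEQ_unique)
  show "(\<lambda>n. orbit_norm ((f ^^ Suc n) x)) \<longlonglongrightarrow> limit_norm (f x)"
    using orbit_norm_tendsto_limit_norm[of "f x"] by (simp add: iter_step)
  show "(\<lambda>n. orbit_norm ((f ^^ Suc n) x)) \<longlonglongrightarrow> limit_norm x"
    using orbit_norm_tendsto_limit_norm by (rule LIMSEQ_Suc)
qed

lemma limit_norm_iter [simp]: "limit_norm ((f ^^ n) x) = limit_norm x"
  by (induction n) auto

lemma limit_norm_eq_0_iff: "limit_norm x = 0 \<longleftrightarrow> (\<lambda>n. (f ^^ n) x) \<longlonglongrightarrow> 0"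
proof
  assume "limit_norm x = 0"
  then have "(\<lambda>n. orbit_norm ((f ^^ n) x)) \<longlonglongrightarrow> 0"
    using orbit_norm_tendsto_limit_norm[of x] by simp
  then show "(\<lambda>n. (f ^^ n) x) \<longlonglongrightarrow> 0"
    by (rule Lim_null_comparison[rotated]) (auto simp: norm_le_orbit_norm)
next
  assume "(\<lambda>n. (f ^^ n) x) \<longlonglongrightarrow> 0"
  then have "(\<lambda>n. L * norm ((f ^^ n) x)) \<longlonglongrightarrow> 0"
    by (intro tendsto_mult_right_zero tendsto_norm_zero)
  then have "(\<lambda>n. orbit_norm ((f ^^ n) x)) \<longlonglongrightarrow> 0"
    by (rule Lim_null_comparison[rotated]) (auto simp: orbit_norm_le)
  then show "limit_norm x = 0"
    using LIMSEQ_unique orbit_norm_tendsto_limit_norm by blast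
qed

lemma contraction_modulo_limit_norm:
  obtains N C where "0 < N" "0 \<le> C" "\<And>x. norm ((f ^^ N) x) \<le> norm x / 2 + C * limit_norm x"
proof -
  obtain P C where P: "linear P" "\<And>x. limit_norm (x - P x) = 0"
      and C: "0 \<le> C" "\<And>x. norm (P x) \<le> C * limit_norm x"
    by (rule limit.projection_along_null_exists) blast
  have "(\<lambda>n. \<Sum>b\<in>Basis. norm ((f ^^ n) (b - P b))) \<longlonglongrightarrow> 0"
    using P(2) by (intro tendsto_null_sum tendsto_norm_zero) (simp add: limit_norm_eq_0_iff)
  then have "\<forall>\<^sub>F n in sequentially. (\<Sum>b\<in>Basis. norm ((f ^^ n) (b - P b))) < 1/2"
    by (rule order_tendstoD) simp
  then obtain N where N: "0 < N" "(\<Sum>b\<in>Basis. norm ((f ^^ N) (b - P b))) < 1/2"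
    unfolding eventually_sequentially
    by (metis le_add1 less_Suc_eq_0_disj add_Suc_right zero_less_Suc)
  have "norm ((f ^^ N) x) \<le> norm x / 2 + (L * C) * limit_norm x" for x
  proof -
    interpret euclidean_seminorm "\<lambda>x. norm ((f ^^ N) (x - P x))"
      unfolding euclidean_seminorm_def
      by (rule seminorm_compose_linear[OF seminorm_norm linear_compose[OF
            linear_compose_sub[OF linear_ident P(1)] linear_iter, unfolded o_def]])
    have "norm ((f ^^ N) (x - P x)) \<le> 1/2 * norm x"
      using le_norm[of x] mult_right_mono[OF less_imp_le[OF N(2)] norm_ge_zero[of x]] by linarith
    moreover have "norm ((f ^^ N) (P x)) \<le> L * (C * limit_norm x)"
      using norm_funpow_le[of N "P x"] mult_left_mono[OF C(2), of L x] L_ge_1 by linarith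
    moreover have "norm ((f ^^ N) x) \<le> norm ((f ^^ N) (x - P x)) + norm ((f ^^ N) (P x))"
      using norm_triangle_ineq[of "(f ^^ N) (x - P x)" "(f ^^ N) (P x)"]
      by (simp add: linear_diff[OF linear_iter])
    ultimately show ?thesis by (simp add: mult.assoc)
  qed
  then show thesis using that[OF N(1), of "L * C"] L_ge_1 C(1) by simp
qed

lemma adapted_norm_exists:
  obtains q \<theta> C where "seminorm q" "\<And>x. norm x \<le> q x" "0 < \<theta>" "\<theta> < 1" "0 \<le> C"
    "\<And>x. q (f x) \<le> \<theta> * q x + C * limit_norm x"
proof -
  obtain N C where N: "0 < N" "0 \<le> C" "\<And>x. norm ((f ^^ N) x) \<le> norm x / 2 + C * limit_norm x"
    by (rule contraction_modulo_limit_norm) blast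
  define q where "q x = (\<Sum>i<N. norm ((f ^^ i) x))" for x
  define \<theta> where "\<theta> = 1 - 1 / (2 * (N * L))"
  have NL: "1 \<le> N * L"
    using N(1) L_ge_1 mult_mono[of 1 "real N" 1 L] by simp
  have q_le: "q x \<le> (N * L) * norm x" for x
    using sum_bounded_above[of "{..<N}" "\<lambda>i. norm ((f ^^ i) x)", OF norm_funpow_le]
    by (simp add: q_def mult.assoc)
  have "q (f x) \<le> \<theta> * q x + C * limit_norm x" for x
  proof -
    have "q (f x) + norm x = q x + norm ((f ^^ N) x)"
      using sum.lessThan_Suc_shift[of "\<lambda>i. norm ((f ^^ i) x)" N]
        sum.lessThan_Suc[of "\<lambda>i. norm ((f ^^ i) x)" N] by (simp add: q_def iter_step)
    moreover have "q x / (2 * (N * L)) \<le> norm x / 2"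
      using q_le[of x] NL by (simp add: field_simps)
    ultimately show ?thesis using N(3)[of x] by (simp add: \<theta>_def left_diff_distrib)
  qed
  moreover have "norm x \<le> q x" for x
    using member_le_sum[of 0 "{..<N}" "\<lambda>i. norm ((f ^^ i) x)"] N(1) by (simp add: q_def)
  moreover have "seminorm q"
    unfolding q_def by (rule seminorm_sum[OF seminorm_compose_linear[OF seminorm_norm linear_iter]])
  moreover have "0 < \<theta>" "\<theta> < 1" using NL by (auto simp: \<theta>_def field_simps)
  ultimately show thesis using that N(2) by blast
qed

end

section \<open>Reachability modulo decaying states\<close>

primrec response :: "('a \<Rightarrow> 'a) \<Rightarrow> (nat \<Rightarrow> 'a) \<Rightarrow> nat \<Rightarrow> 'a::ab_group_add" where
  "response f g 0 = 0"
| "response f g (Suc j) = f (response f g j) + g j"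

lemma response_cong: "(\<And>i. i < j \<Longrightarrow> g i = h i) \<Longrightarrow> response f g j = response f h j"
  by (induction j) auto

lemma response_add:
  "linear f \<Longrightarrow> response f (\<lambda>i. g i + h i) j = response f g j + response f h j"
  by (induction j) (auto simp: linear_add)

lemma response_scale: "linear f \<Longrightarrow> response f (\<lambda>i. c *\<^sub>R g i) j = c *\<^sub>R response f g j"
  by (induction j) (auto simp: linear_scale scaleR_add_right)

lemma response_zero: "linear f \<Longrightarrow> response f (\<lambda>_. 0) j = 0"
  by (induction j) (auto simp: linear_0)

lemma linear_response:
  assumes "linear f" "\<And>i. linear (g i)"
  shows "linear (\<lambda>x. response f (\<lambda>i. g i x) j)"
proof (induction j)
  case (Suc j)
  show ?case
    using linear_compose_add[OF linear_compose[OF Suc assms(1)] assms(2)[of j]] by (simp add: o_def)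
qed (simp add: linear_zero)

lemma increasing_subspaces_stationary:
  fixes Y :: "nat \<Rightarrow> 'a::euclidean_space set"
  assumes subspace: "\<And>j. subspace (Y j)" and increasing: "\<And>j. Y j \<subseteq> Y (Suc j)"
    and propagates: "\<And>j. Y (Suc j) = Y j \<Longrightarrow> Y (Suc (Suc j)) = Y (Suc j)"
  shows "Y (Suc DIM('a)) = Y DIM('a)"
proof (rule ccontr)
  assume moving: "Y (Suc DIM('a)) \<noteq> Y DIM('a)"
  have strict: "Y j \<subset> Y (Suc j)" if "j \<le> DIM('a)" for j
  proof -
    have "Y (Suc j) \<noteq> Y j"
      using that moving by (induction rule: inc_induct) (use propagates in auto)
    then show ?thesis using increasing by blast
  qed
  have "j \<le> dim (Y j)" if "j \<le> Suc DIM('a)" for j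
    using that
  proof (induction j)
    case (Suc j)
    have "dim (Y j) < dim (Y (Suc j))"
      using strict[of j] Suc.prems subspace
      by (intro dim_psubset) (simp add: span_eq_iff[THEN iffD2])
    then show ?case using Suc by simp
  qed simp
  from this[of "Suc DIM('a)"] show False
    using dim_subset_UNIV[of "Y (Suc DIM('a))"] by simp
qed

context power_bounded_map
begin

lemma limit_norm_response_le: "limit_norm (response f g j) \<le> (\<Sum>i<j. limit_norm (g i))"
proof (induction j)
  case (Suc j)
  then show ?case
    using limit.triangle[of "f (response f g j)" "g j"] by simp
qed simp

lemma norm_response_le: "norm (response f g j) \<le> L * (\<Sum>i<j. norm (g i))"
proof -
  have "norm ((f ^^ m) (response f g j)) \<le> L * (\<Sum>i<j. norm (g i))" for m
  proof (induction j arbitrary: m)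
    case (Suc j)
    have "(f ^^ m) (response f g (Suc j)) = (f ^^ Suc m) (response f g j) + (f ^^ m) (g j)"
      by (simp add: linear_add[OF linear_iter] iter_step)
    then show ?case
      using norm_triangle_mono[OF Suc[of "Suc m"] norm_funpow_le[of m "g j"]]
      by (simp add: distrib_left)
  qed (simp add: linear_0[OF linear_iter])
  from this[of 0] show ?thesis by simp
qed

end

locale controlled_map = power_bounded_map f L
  for f :: "'a::euclidean_space \<Rightarrow> 'a" and L :: real +
  fixes B :: "'b::euclidean_space \<Rightarrow> 'a"
  assumes linear_B: "linear B"
begin

primrec reach :: "nat \<Rightarrow> 'a set" where
  "reach 0 = {x. limit_norm x = 0}"
| "reach (Suc j) = {x. \<exists>y\<in>reach j. \<exists>v. limit_norm (x - (f y + B v)) = 0}"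

lemma subspace_reach: "subspace (reach j)"
proof (induction j)
  case (Suc j)
  show ?case
  proof (rule subspaceI)
    have "limit_norm (0 - (f 0 + B 0)) = 0"
      by (simp add: linear_0[OF linear] linear_0[OF linear_B])
    then show "0 \<in> reach (Suc j)" using subspace_0[OF Suc] by auto
  next
    fix x x' assume "x \<in> reach (Suc j)" "x' \<in> reach (Suc j)"
    then obtain y v y' v' where y: "y \<in> reach j" "limit_norm (x - (f y + B v)) = 0"
      and y': "y' \<in> reach j" "limit_norm (x' - (f y' + B v')) = 0" by auto
    have split: "x + x' - (f (y + y') + B (v + v')) = (x - (f y + B v)) + (x' - (f y' + B v'))"
      by (simp add: linear_add[OF linear] linear_add[OF linear_B])
    have "limit_norm (x + x' - (f (y + y') + B (v + v'))) = 0"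
      unfolding split using y(2) y'(2) by (rule limit.null_add)
    then show "x + x' \<in> reach (Suc j)" using subspace_add[OF Suc y(1) y'(1)] by auto
  next
    fix x and c :: real assume "x \<in> reach (Suc j)"
    then obtain y v where y: "y \<in> reach j" "limit_norm (x - (f y + B v)) = 0" by auto
    have "c *\<^sub>R x - (f (c *\<^sub>R y) + B (c *\<^sub>R v)) = c *\<^sub>R (x - (f y + B v))"
      by (simp add: linear_scale[OF linear] linear_scale[OF linear_B]
          scaleR_diff_right scaleR_add_right)
    then have "limit_norm (c *\<^sub>R x - (f (c *\<^sub>R y) + B (c *\<^sub>R v))) = 0"
      using y(2) by (simp add: limit.scale)
    then show "c *\<^sub>R x \<in> reach (Suc j)" using subspace_scale[OF Suc y(1)] by auto
  qed
qed (simp add: limit.subspace_null)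

lemma reach_subset_Suc: "reach j \<subseteq> reach (Suc j)"
proof (induction j)
  case 0
  have "limit_norm (x - (f 0 + B 0)) = 0" if "limit_norm x = 0" for x
    using that by (simp add: linear_0[OF linear] linear_0[OF linear_B])
  then show ?case by (simp add: subset_iff) (metis limit.zero)
next
  case (Suc j)
  show ?case
  proof
    fix x assume "x \<in> reach (Suc j)"
    then obtain y v where y: "y \<in> reach j" "limit_norm (x - (f y + B v)) = 0"
      by auto
    from y(1) Suc have "y \<in> reach (Suc j)" by (rule set_mp[rotated])
    with y(2) show "x \<in> reach (Suc (Suc j))"
      unfolding reach.simps(2)[of "Suc j"] by blast
  qed
qed

lemma null_subset_reach: "{x. limit_norm x = 0} \<subseteq> reach j"
  using lift_Suc_mono_le[of reach 0 j, OF reach_subset_Suc] by simp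

lemma reach_Suc_DIM: "reach (Suc DIM('a)) = reach DIM('a)"
  by (rule increasing_subspaces_stationary[where Y = reach, OF subspace_reach reach_subset_Suc])
    simp

lemma step_in_reach_DIM:
  assumes "y \<in> reach DIM('a)"
  shows "f y + B v \<in> reach DIM('a)"
proof -
  have "limit_norm (f y + B v - (f y + B v)) = 0" by simp
  then have "f y + B v \<in> reach (Suc DIM('a))"
    using assms unfolding reach.simps by blast
  then show ?thesis by (simp only: reach_Suc_DIM)
qed

text \<open>Let \<open>G = f + B K\<close> be a stabilizing feedback and \<open>R = reach DIM('a)\<close>. Then \<open>f\<close> and \<open>G\<close> agree
  modulo \<open>R\<close>, and as \<open>f\<close> maps \<open>R\<close> onto itself isometrically, \<open>x\<close> is as close to \<open>R\<close> as
  \<open>(f ^^ n) x\<close>, that is, as \<open>(G ^^ n) x\<close>, which tends to \<open>0\<close>.\<close>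

lemma reach_eq_UNIV:
  assumes stabilized: "\<And>x. (\<lambda>n. ((\<lambda>x. f x + B (K x)) ^^ n) x) \<longlonglongrightarrow> 0"
  shows "reach DIM('a) = UNIV"
proof -
  define G where "G x = f x + B (K x)" for x
  define R where "R = reach DIM('a)"
  have R: "subspace R" "{x. limit_norm x = 0} \<subseteq> R"
    unfolding R_def by (rule subspace_reach null_subset_reach)+
  have diff: "(f ^^ n) x - (G ^^ n) x \<in> R" for n x
  proof (induction n)
    case (Suc n)
    have "(f ^^ Suc n) x - (G ^^ Suc n) x = f ((f ^^ n) x - (G ^^ n) x) + B (- K ((G ^^ n) x))"
      by (simp add: G_def linear_diff[OF linear] linear_neg[OF linear_B])
    then show ?case using step_in_reach_DIM Suc by (simp add: R_def)
  qed (simp add: subspace_0[OF R(1)])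
  have iter: "(f ^^ n) ` R \<subseteq> R" for n
    using step_in_reach_DIM[of _ 0] by (induction n) (auto simp: R_def linear_0[OF linear_B])
  have "x \<in> R" for x
  proof (rule limit.mem_subspace_of_approximations[OF R])
    fix e :: real assume "0 < e"
    have "(\<lambda>n. L * norm ((G ^^ n) x)) \<longlonglongrightarrow> 0"
      using stabilized[of x] unfolding G_def[abs_def]
      by (intro tendsto_mult_right_zero tendsto_norm_zero)
    then obtain n where n: "L * norm ((G ^^ n) x) < e"
      using order_tendstoD(2)[OF _ \<open>0 < e\<close>] eventually_happens'[OF sequentially_bot] by blast
    obtain y where y: "y \<in> R" "limit_norm ((f ^^ n) x - (G ^^ n) x - (f ^^ n) y) = 0"
      by (rule limit.isometry_onto_subspace_modulo_null[OF linear_iter limit_norm_iter R iter diff])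
    have "limit_norm (x - y) = limit_norm ((f ^^ n) x - (f ^^ n) y)"
      by (simp flip: linear_diff[OF linear_iter])
    also have "\<dots> \<le> limit_norm ((f ^^ n) x - (G ^^ n) x - (f ^^ n) y) + limit_norm ((G ^^ n) x)"
      using limit.triangle[of "(f ^^ n) x - (G ^^ n) x - (f ^^ n) y" "(G ^^ n) x"] by simp
    also have "\<dots> < e"
      using y(2) n limit_norm_le[of "(G ^^ n) x"] by linarith
    finally show "\<exists>y\<in>R. limit_norm (x - y) < e" using y(1) by blast
  qed
  then show ?thesis by (auto simp: R_def)
qed

lemma reach_imp_response:
  assumes "x \<in> reach j"
  obtains u where "limit_norm (x - response f (\<lambda>i. B (u i)) j) = 0"
  using assms
proof (induction j arbitrary: x thesis)
  case (Suc j)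
  then obtain y v where y: "y \<in> reach j" "limit_norm (x - (f y + B v)) = 0" by auto
  obtain u where u: "limit_norm (y - response f (\<lambda>i. B (u i)) j) = 0"
    using Suc.IH[OF _ y(1)] .
  have "response f (\<lambda>i. B ((u(j := v)) i)) j = response f (\<lambda>i. B (u i)) j"
    by (rule response_cong) simp
  then have split: "x - response f (\<lambda>i. B ((u(j := v)) i)) (Suc j)
      = (x - (f y + B v)) + f (y - response f (\<lambda>i. B (u i)) j)"
    by (simp add: linear_diff[OF linear])
  have "limit_norm (x - response f (\<lambda>i. B ((u(j := v)) i)) (Suc j)) = 0"
    unfolding split using y(2) u by (intro limit.null_add) simp_all
  then show ?case by (rule Suc.prems(1))
qed simp

end

section \<open>Saturated controls\<close>

locale block_steering = controlled_map f L B
  for f :: "'a::euclidean_space \<Rightarrow> 'a" and L :: real and B :: "'b::euclidean_space \<Rightarrow> 'a" +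
  fixes k :: nat and F :: "nat \<Rightarrow> 'a \<Rightarrow> 'b" and C :: real
  assumes linear_F: "linear (F i)"
    and norm_F_le: "i < k \<Longrightarrow> norm (F i x) \<le> C * limit_norm x"
    and steering: "limit_norm (x - response f (\<lambda>i. B (F i x)) k) = 0"
    and C_nonneg: "0 \<le> C"

lemma (in controlled_map) linear_steering_exists:
  assumes "reach k = UNIV"
  obtains G where "\<And>i. linear (G i)" "\<And>x. limit_norm (x - response f (\<lambda>i. B (G i x)) k) = 0"
proof -
  have "\<forall>b. \<exists>u. limit_norm (b - response f (\<lambda>i. B (u i)) k) = 0"
    using assms by (metis UNIV_I reach_imp_response)
  then obtain u where u: "\<And>b. limit_norm (b - response f (\<lambda>i. B (u b i)) k) = 0"
    by metis
  define G where "G i x = (\<Sum>b\<in>Basis. (x \<bullet> b) *\<^sub>R u b i)" for i x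
  have linear_G: "linear (G i)" for i
    unfolding G_def
    by (intro linearI) (simp_all add: inner_add_left scaleR_add_left sum.distrib scaleR_sum_right)
  have G_Basis: "G i b = u b i" if "b \<in> Basis" for i b
    using that by (simp add: G_def inner_Basis if_distrib[of "\<lambda>a. a *\<^sub>R _"] cong: if_cong)
  interpret G: euclidean_seminorm "\<lambda>x. limit_norm (x - response f (\<lambda>i. B (G i x)) k)"
    unfolding euclidean_seminorm_def
    by (rule seminorm_compose_linear[OF limit.seminorm_axioms linear_compose_sub[OF linear_ident
          linear_response[OF linear linear_compose[OF linear_G linear_B, unfolded o_def]]]])
  have "limit_norm (x - response f (\<lambda>i. B (G i x)) k) = 0" for x
    using G.le_norm[of x] G.nonneg[of x] by (simp add: G_Basis u del: G.nonneg)
  with linear_G show thesis by (rule that)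
qed

lemma (in controlled_map) block_steering_exists:
  assumes "reach k = UNIV"
  obtains F C where "block_steering f L B k F C"
proof -
  obtain G where linear_G: "\<And>i. linear (G i)"
      and steering_G: "\<And>x. limit_norm (x - response f (\<lambda>i. B (G i x)) k) = 0"
    using linear_steering_exists[OF assms] by blast
  obtain P C where P: "linear P" "\<And>x. limit_norm (x - P x) = 0"
      and C: "0 \<le> C" "\<And>x. norm (P x) \<le> C * limit_norm x"
    by (rule limit.projection_along_null_exists) blast
  define D where "D = (\<Sum>i<k. onorm (G i))"
  have norm_G_le: "norm (G i x) \<le> D * norm x" if "i < k" for i x
  proof -
    have bounded: "bounded_linear (G i)" for i
      using linear_G by (simp add: linear_linear)
    have "onorm (G i) \<le> D"
      unfolding D_def using that by (intro member_le_sum onorm_pos_le bounded) auto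
    then show ?thesis
      by (intro order_trans[OF onorm[OF bounded] mult_right_mono]) auto
  qed
  have "0 \<le> D"
    unfolding D_def by (intro sum_nonneg onorm_pos_le linear_G linear_linear[THEN iffD2])
  have "block_steering f L B k (\<lambda>i x. G i (P x)) (D * C)"
  proof (intro block_steering.intro controlled_map_axioms block_steering_axioms.intro)
    show "linear (\<lambda>x. G i (P x))" for i
      using linear_compose[OF P(1) linear_G] by (simp add: o_def)
    show "norm (G i (P x)) \<le> D * C * limit_norm x" if "i < k" for i x
      using norm_G_le[OF that, of "P x"] mult_left_mono[OF C(2) \<open>0 \<le> D\<close>, of x]
      by (simp add: mult.assoc)
    have split: "x - response f (\<lambda>i. B (G i (P x))) k
        = (x - P x) + (P x - response f (\<lambda>i. B (G i (P x))) k)" for x by simp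
    show "limit_norm (x - response f (\<lambda>i. B (G i (P x))) k) = 0" for x
      unfolding split using P(2) steering_G by (rule limit.null_add)
    show "0 \<le> D * C" using \<open>0 \<le> D\<close> C(1) by simp
  qed
  then show thesis by (rule that)
qed

context block_steering
begin

definition saturated_control :: "real \<Rightarrow> nat \<Rightarrow> 'a \<Rightarrow> 'b" where
  "saturated_control r i y = - (r / max r (limit_norm y)) *\<^sub>R F i ((f ^^ k) y)"

lemma continuous_on_saturated_control:
  assumes "0 < r"
  shows "continuous_on UNIV (saturated_control r i)"
  unfolding saturated_control_def[abs_def]
  using assms linear_compose[OF linear_iter linear_F]
  by (intro continuous_intros limit.continuous_on linear_continuous_on
      linear_conv_bounded_linear[THEN iffD1]) (auto simp: o_def)

lemma norm_saturated_control_le: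
  assumes "0 < r" "i < k"
  shows "norm (saturated_control r i y) \<le> C * min r (limit_norm y)"
proof -
  have "r / max r (limit_norm y) * limit_norm y = min r (limit_norm y)"
    using assms(1) by (simp add: max_def min_def)
  moreover have "norm (saturated_control r i y) \<le> r / max r (limit_norm y) * (C * limit_norm y)"
    using assms norm_F_le[of i "(f ^^ k) y"]
    by (auto simp: saturated_control_def simp del: times_divide_eq_left intro!: mult_left_mono)
  ultimately show ?thesis by (metis mult.left_commute)
qed

lemma limit_norm_saturated_block_le:
  assumes "0 < r"
  shows "limit_norm ((f ^^ k) y + response f (\<lambda>i. B (saturated_control r i y)) k)
    \<le> max (limit_norm y - r) 0"
proof -
  define \<sigma> where "\<sigma> = r / max r (limit_norm y)"
  define z where "z = (f ^^ k) y"
  define w where "w = response f (\<lambda>i. B (F i z)) k"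
  have \<sigma>: "\<sigma> \<le> 1" "(1 - \<sigma>) * limit_norm y = max (limit_norm y - r) 0"
    using assms by (auto simp: \<sigma>_def max_def field_simps)
  have "response f (\<lambda>i. B (saturated_control r i y)) k = - \<sigma> *\<^sub>R w"
    unfolding saturated_control_def w_def z_def[symmetric] \<sigma>_def[symmetric]
      linear_scale[OF linear_B]
    by (rule response_scale[OF linear])
  then have "z + response f (\<lambda>i. B (saturated_control r i y)) k = (1 - \<sigma>) *\<^sub>R z + \<sigma> *\<^sub>R (z - w)"
    by (simp add: algebra_simps)
  then have "limit_norm (z + response f (\<lambda>i. B (saturated_control r i y)) k)
      \<le> \<bar>1 - \<sigma>\<bar> * limit_norm z + \<bar>\<sigma>\<bar> * limit_norm (z - w)"
    by (metis limit.scale limit.triangle)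
  also have "\<dots> = (1 - \<sigma>) * limit_norm y"
    using \<sigma>(1) steering[of z] by (simp add: w_def z_def)
  finally show ?thesis by (simp add: \<sigma>(2) z_def)
qed

end

section \<open>Families with bounded moments\<close>

definition bounded_moments ::
    "nat \<Rightarrow> 'w measure \<Rightarrow> ('i \<Rightarrow> 'w \<Rightarrow> 'v::real_normed_vector) \<Rightarrow> bool" where
  "bounded_moments p M X \<longleftrightarrow> (\<forall>i. X i \<in> borel_measurable M) \<and>
     (SUP i. \<integral>\<^sup>+ \<omega>. ennreal (norm (X i \<omega>) ^ p) \<partial>M) < \<infinity>"

lemma bounded_momentsD_measurable: "bounded_moments p M X \<Longrightarrow> X i \<in> borel_measurable M"
  by (simp add: bounded_moments_def)

lemma bounded_momentsE:
  assumes "bounded_moments p M X"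
  obtains K where "\<And>i. integrable M (\<lambda>\<omega>. norm (X i \<omega>) ^ p)"
    "\<And>i. (\<integral>\<omega>. norm (X i \<omega>) ^ p \<partial>M) \<le> K"
proof -
  have [measurable]: "\<And>i. X i \<in> borel_measurable M"
    using assms by (rule bounded_momentsD_measurable)
  obtain K where K: "0 \<le> K" "(SUP i. \<integral>\<^sup>+ \<omega>. ennreal (norm (X i \<omega>) ^ p) \<partial>M) = ennreal K"
    using assms unfolding bounded_moments_def
    by (cases "SUP i. \<integral>\<^sup>+ \<omega>. ennreal (norm (X i \<omega>) ^ p) \<partial>M") auto
  have nn_integral_le: "(\<integral>\<^sup>+ \<omega>. ennreal (norm (X i \<omega>) ^ p) \<partial>M) \<le> ennreal K" for i
    unfolding K(2)[symmetric] by (rule SUP_upper) simp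
  have integrable: "integrable M (\<lambda>\<omega>. norm (X i \<omega>) ^ p)" for i
    by (rule integrableI_bounded) (use nn_integral_le[of i] in \<open>auto simp: order_le_less_trans\<close>)
  have "(\<integral>\<omega>. norm (X i \<omega>) ^ p \<partial>M) \<le> K" for i
    using nn_integral_le[of i] nn_integral_eq_integral[OF integrable[of i]] K(1) by simp
  with integrable show thesis by (rule that)
qed

lemma bounded_momentsI:
  assumes "\<And>i. X i \<in> borel_measurable M" "\<And>i. integrable M (\<lambda>\<omega>. norm (X i \<omega>) ^ p)"
    and "\<And>i. (\<integral>\<omega>. norm (X i \<omega>) ^ p \<partial>M) \<le> K"
  shows "bounded_moments p M X"
proof -
  have "(SUP i. \<integral>\<^sup>+ \<omega>. ennreal (norm (X i \<omega>) ^ p) \<partial>M) \<le> ennreal K"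
    using assms(3) by (intro SUP_least) (simp add: nn_integral_eq_integral[OF assms(2)] ennreal_leI)
  then show ?thesis
    using assms(1) by (simp add: bounded_moments_def order_le_less_trans)
qed

lemma bounded_moments_mono:
  assumes "bounded_moments p M Y" "\<And>i. X i \<in> borel_measurable M"
    and dominated: "\<And>i \<omega>. norm (X i \<omega>) \<le> norm (Y i \<omega>)"
  shows "bounded_moments p M X"
proof -
  have "(SUP i. \<integral>\<^sup>+ \<omega>. ennreal (norm (X i \<omega>) ^ p) \<partial>M) \<le> (SUP i. \<integral>\<^sup>+ \<omega>. ennreal (norm (Y i \<omega>) ^ p) \<partial>M)"
    by (intro SUP_mono' nn_integral_mono ennreal_leI power_mono dominated) auto
  then show ?thesis
    using assms(1,2) by (simp add: bounded_moments_def order_le_less_trans)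
qed

lemma bounded_moments_norm: "bounded_moments p M X \<Longrightarrow> bounded_moments p M (\<lambda>i \<omega>. norm (X i \<omega>))"
  by (auto simp: bounded_moments_def intro: measurable_compose[OF _ borel_measurable_norm])

lemma bounded_moments_reindex: "bounded_moments p M X \<Longrightarrow> bounded_moments p M (\<lambda>j. X (h j))"
proof -
  assume "bounded_moments p M X"
  moreover have "(SUP j. \<integral>\<^sup>+ \<omega>. ennreal (norm (X (h j) \<omega>) ^ p) \<partial>M)
      \<le> (SUP i. \<integral>\<^sup>+ \<omega>. ennreal (norm (X i \<omega>) ^ p) \<partial>M)"
    by (intro SUP_least SUP_upper) simp
  ultimately show ?thesis
    by (simp add: bounded_moments_def order_le_less_trans)
qed

lemma power_add_le: "(a + b) ^ p \<le> 2 ^ p * (a ^ p + b ^ p)" if "0 \<le> a" "0 \<le> b" for a b :: real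
proof -
  have "(a + b) ^ p \<le> (2 * max a b) ^ p"
    using that by (intro power_mono) auto
  also have "\<dots> \<le> 2 ^ p * (a ^ p + b ^ p)"
    using that by (simp add: power_mult_distrib max_def)
  finally show ?thesis .
qed

lemma bounded_moments_add:
  fixes X Y :: "'i \<Rightarrow> 'w \<Rightarrow> 'v::{real_normed_vector, second_countable_topology}"
  assumes X: "bounded_moments p M X" and Y: "bounded_moments p M Y"
  shows "bounded_moments p M (\<lambda>i \<omega>. X i \<omega> + Y i \<omega>)"
proof -
  note [measurable] = X[THEN bounded_momentsD_measurable] Y[THEN bounded_momentsD_measurable]
  obtain K where K: "\<And>i. integrable M (\<lambda>\<omega>. norm (X i \<omega>) ^ p)" "\<And>i. (\<integral>\<omega>. norm (X i \<omega>) ^ p \<partial>M) \<le> K"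
    using X by (rule bounded_momentsE) blast
  obtain K' where K': "\<And>i. integrable M (\<lambda>\<omega>. norm (Y i \<omega>) ^ p)" "\<And>i. (\<integral>\<omega>. norm (Y i \<omega>) ^ p \<partial>M) \<le> K'"
    using Y by (rule bounded_momentsE) blast
  have pointwise: "norm (X i \<omega> + Y i \<omega>) ^ p \<le> 2 ^ p * (norm (X i \<omega>) ^ p + norm (Y i \<omega>) ^ p)" for i \<omega>
    by (rule order_trans[OF power_mono[OF norm_triangle_ineq] power_add_le]) auto
  have majorant: "integrable M (\<lambda>\<omega>. 2 ^ p * (norm (X i \<omega>) ^ p + norm (Y i \<omega>) ^ p))" for i
    using K(1) K'(1) by simp
  have integrable: "integrable M (\<lambda>\<omega>. norm (X i \<omega> + Y i \<omega>) ^ p)" for i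
    by (rule Bochner_Integration.integrable_bound[OF majorant]) (use pointwise in auto)
  show ?thesis
  proof (rule bounded_momentsI[OF _ integrable])
    fix i
    have "(\<integral>\<omega>. norm (X i \<omega> + Y i \<omega>) ^ p \<partial>M)
        \<le> (\<integral>\<omega>. 2 ^ p * (norm (X i \<omega>) ^ p + norm (Y i \<omega>) ^ p) \<partial>M)"
      by (rule integral_mono[OF integrable majorant pointwise])
    also have "\<dots> \<le> 2 ^ p * (K + K')"
      using K K' by (simp add: add_mono)
    finally show "(\<integral>\<omega>. norm (X i \<omega> + Y i \<omega>) ^ p \<partial>M) \<le> 2 ^ p * (K + K')" .
  qed measurable
qed

lemma bounded_moments_scale:
  fixes X :: "'i \<Rightarrow> 'w \<Rightarrow> 'v::{real_normed_vector, second_countable_topology}"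
  assumes X: "bounded_moments p M X"
  shows "bounded_moments p M (\<lambda>i \<omega>. c *\<^sub>R X i \<omega>)"
proof -
  note [measurable] = X[THEN bounded_momentsD_measurable]
  obtain K where K: "\<And>i. integrable M (\<lambda>\<omega>. norm (X i \<omega>) ^ p)" "\<And>i. (\<integral>\<omega>. norm (X i \<omega>) ^ p \<partial>M) \<le> K"
    using X by (rule bounded_momentsE) blast
  show ?thesis
    by (rule bounded_momentsI[where K = "\<bar>c\<bar> ^ p * K"])
       (use K in \<open>auto simp: power_mult_distrib intro!: mult_left_mono\<close>)
qed

lemma bounded_moments_sum:
  fixes X :: "'j \<Rightarrow> 'i \<Rightarrow> 'w \<Rightarrow> 'v::{real_normed_vector, second_countable_topology}"
  assumes "0 < p" "\<And>j. j \<in> J \<Longrightarrow> bounded_moments p M (X j)"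
  shows "bounded_moments p M (\<lambda>i \<omega>. \<Sum>j\<in>J. X j i \<omega>)"
  using assms(2)
proof (induction J rule: infinite_finite_induct)
  case (insert j J)
  then show ?case by (simp add: bounded_moments_add)
qed (use assms(1) in \<open>simp_all add: bounded_moments_def power_0_left\<close>)

lemma (in finite_measure) bounded_moments_const: "bounded_moments p M (\<lambda>_ _. c)"
  by (rule bounded_momentsI) auto

lemma power_le_1_plus_power: "x ^ p \<le> 1 + x ^ q" if "0 \<le> x" "p \<le> q" for x :: real
proof (cases "x \<le> 1")
  case True
  then show ?thesis using that by (simp add: power_le_one add_increasing2)
next
  case False
  then show ?thesis using that power_increasing[of p q x] by linarith
qed

lemma (in prob_space) integrable_power_le:
  fixes X :: "'a \<Rightarrow> 'v::real_normed_vector"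
  assumes [measurable]: "X \<in> borel_measurable M"
    and integrable: "integrable M (\<lambda>\<omega>. norm (X \<omega>) ^ q)" and "p \<le> q"
  shows "integrable M (\<lambda>\<omega>. norm (X \<omega>) ^ p)"
    and "expectation (\<lambda>\<omega>. norm (X \<omega>) ^ p) \<le> 1 + expectation (\<lambda>\<omega>. norm (X \<omega>) ^ q)"
proof -
  have pointwise: "norm (X \<omega>) ^ p \<le> 1 + norm (X \<omega>) ^ q" for \<omega>
    using \<open>p \<le> q\<close> by (intro power_le_1_plus_power) auto
  have majorant: "integrable M (\<lambda>\<omega>. 1 + norm (X \<omega>) ^ q)" using integrable by simp
  show integrable_p: "integrable M (\<lambda>\<omega>. norm (X \<omega>) ^ p)"
    by (rule Bochner_Integration.integrable_bound[OF majorant]) (use pointwise in auto)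
  show "expectation (\<lambda>\<omega>. norm (X \<omega>) ^ p) \<le> 1 + expectation (\<lambda>\<omega>. norm (X \<omega>) ^ q)"
    using integral_mono[OF integrable_p majorant pointwise] integrable by (simp add: prob_space)
qed

lemma (in prob_space) bounded_moments_le:
  assumes X: "bounded_moments q M X" and "p \<le> q"
  shows "bounded_moments p M X"
proof -
  note [measurable] = X[THEN bounded_momentsD_measurable]
  obtain K where K: "\<And>i. integrable M (\<lambda>\<omega>. norm (X i \<omega>) ^ q)"
      "\<And>i. expectation (\<lambda>\<omega>. norm (X i \<omega>) ^ q) \<le> K"
    using X by (rule bounded_momentsE) blast
  show ?thesis
  proof (rule bounded_momentsI)
    show "integrable M (\<lambda>\<omega>. norm (X i \<omega>) ^ p)" for i
      by (rule integrable_power_le(1)[OF _ K(1) \<open>p \<le> q\<close>]) simp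
    show "expectation (\<lambda>\<omega>. norm (X i \<omega>) ^ p) \<le> 1 + K" for i
      using integrable_power_le(2)[OF _ K(1) \<open>p \<le> q\<close>, of i] K(2)[of i] by simp
  qed simp
qed

lemma convex_combination_power_le:
  fixes u v \<theta> :: real
  assumes "0 \<le> u" "0 \<le> v" "0 \<le> \<theta>" "\<theta> \<le> 1"
  shows "(\<theta> * u + (1 - \<theta>) * v) ^ p \<le> \<theta> * u ^ p + (1 - \<theta>) * v ^ p"
proof -
  have "convex_on {0::real..} (\<lambda>x. x ^ p)"
    by (cases "even p") (auto intro: convex_power_odd convex_on_subset[OF convex_power_even])
  from convex_onD[OF this, of "1 - \<theta>" u v] show ?thesis
    using assms by simp
qed

lemma contracting_step_power_le:
  fixes z z' b \<theta> :: real
  assumes "0 \<le> z" "0 \<le> z'" "z' \<le> \<theta> * z + b" and \<theta>: "0 \<le> \<theta>" "\<theta> < 1"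
  shows "z' ^ p \<le> \<theta> * z ^ p + (1 - \<theta>) * (\<bar>b\<bar> / (1 - \<theta>)) ^ p"
proof -
  have "z' \<le> \<theta> * z + (1 - \<theta>) * (\<bar>b\<bar> / (1 - \<theta>))"
    using assms(3) \<theta>(2) by simp
  then have "z' ^ p \<le> (\<theta> * z + (1 - \<theta>) * (\<bar>b\<bar> / (1 - \<theta>))) ^ p"
    using assms(2) by (rule power_mono)
  also have "\<dots> \<le> \<theta> * z ^ p + (1 - \<theta>) * (\<bar>b\<bar> / (1 - \<theta>)) ^ p"
    using assms(1) \<theta> by (intro convex_combination_power_le) auto
  finally show ?thesis .
qed

lemma (in prob_space) bounded_moments_contracting_recursion:
  fixes Z b :: "nat \<Rightarrow> 'a \<Rightarrow> real"
  assumes Z [measurable]: "\<And>t. Z t \<in> borel_measurable M" and nonneg: "\<And>t \<omega>. 0 \<le> Z t \<omega>"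
    and integrable_Z_0: "integrable M (\<lambda>\<omega>. Z 0 \<omega> ^ p)"
    and Z_Suc: "\<And>t \<omega>. Z (Suc t) \<omega> \<le> \<theta> * Z t \<omega> + b t \<omega>"
    and b: "bounded_moments p M b" and \<theta>: "0 \<le> \<theta>" "\<theta> < 1"
  shows "bounded_moments p M Z"
proof -
  define b' where "b' t \<omega> = (1 / (1 - \<theta>)) *\<^sub>R b t \<omega>" for t \<omega>
  have "bounded_moments p M b'"
    unfolding b'_def using b by (rule bounded_moments_scale)
  then obtain K where K: "\<And>t. integrable M (\<lambda>\<omega>. norm (b' t \<omega>) ^ p)"
      "\<And>t. expectation (\<lambda>\<omega>. norm (b' t \<omega>) ^ p) \<le> K"
    by (rule bounded_momentsE) blast
  have pointwise: "Z (Suc t) \<omega> ^ p \<le> \<theta> * Z t \<omega> ^ p + (1 - \<theta>) * norm (b' t \<omega>) ^ p" for t \<omega>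
    using contracting_step_power_le[OF nonneg nonneg Z_Suc \<theta>] \<theta>(2) by (simp add: b'_def)
  have integrable: "integrable M (\<lambda>\<omega>. Z t \<omega> ^ p)" for t
  proof (induction t)
    case (Suc t)
    have "integrable M (\<lambda>\<omega>. \<theta> * Z t \<omega> ^ p + (1 - \<theta>) * norm (b' t \<omega>) ^ p)"
      using Suc K(1) by simp
    then show ?case
      by (rule Bochner_Integration.integrable_bound) (use pointwise nonneg \<theta> in auto)
  qed (rule integrable_Z_0)
  have "expectation (\<lambda>\<omega>. Z (Suc t) \<omega> ^ p) \<le> \<theta> * expectation (\<lambda>\<omega>. Z t \<omega> ^ p) + (1 - \<theta>) * K" for t
  proof -
    have "expectation (\<lambda>\<omega>. Z (Suc t) \<omega> ^ p)
        \<le> expectation (\<lambda>\<omega>. \<theta> * Z t \<omega> ^ p + (1 - \<theta>) * norm (b' t \<omega>) ^ p)"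
      using integrable K(1) pointwise by (intro integral_mono) auto
    also have "\<dots> = \<theta> * expectation (\<lambda>\<omega>. Z t \<omega> ^ p) + (1 - \<theta>) * expectation (\<lambda>\<omega>. norm (b' t \<omega>) ^ p)"
      using integrable K(1) by simp
    finally show ?thesis
      using mult_left_mono[OF K(2)[of t], of "1 - \<theta>"] \<theta>(2) by linarith
  qed
  then have "expectation (\<lambda>\<omega>. Z t \<omega> ^ p)
      \<le> max (expectation (\<lambda>\<omega>. Z 0 \<omega> ^ p)) ((1 - \<theta>) * K / (1 - \<theta>))" for t
    by (rule bounded_of_contracting_recursion[OF \<theta>, of "\<lambda>t. expectation (\<lambda>\<omega>. Z t \<omega> ^ p)"])
  then show ?thesis
    using integrable nonneg by (intro bounded_momentsI) (auto simp: abs_of_nonneg)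
qed

section \<open>Second moments of the Lindley recursion\<close>

lemma sum_inverse_squares_le: "(\<Sum>j<n. 1 / (real (Suc j))\<^sup>2) \<le> 2"
proof -
  have "(\<Sum>j<n. 1 / (real (Suc j))\<^sup>2) \<le> 2 - 2 / Suc n"
  proof (induction n)
    case (Suc n)
    have "1 / (real (Suc n))\<^sup>2 \<le> 2 / Suc n - 2 / Suc (Suc n)"
      by (simp add: divide_simps power2_eq_square algebra_simps)
    then show ?case using Suc by simp
  qed simp
  then show ?thesis by (rule order_trans) simp
qed

text \<open>The square \<open>\<eta>\<^sup>2\<close> only contributes when \<open>v\<close> or \<open>\<eta>\<close> exceeds \<open>a\<close>.\<close>

lemma lindley_step_le:
  fixes v \<eta> a :: real
  assumes "0 \<le> v" "0 < a"
  shows "(max 0 (v - 2 * a + \<eta>))\<^sup>2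
    \<le> (max 0 (v - 2 * a))\<^sup>2 + 2 * (max 0 (v - 2 * a) * \<eta>) + (v\<^sup>2 * \<eta>\<^sup>2 + \<eta> ^ 4) / a\<^sup>2"
proof -
  have remainder: "\<eta>\<^sup>2 \<le> (v\<^sup>2 * \<eta>\<^sup>2 + \<eta> ^ 4) / a\<^sup>2" if "a \<le> v \<or> a \<le> \<eta>"
  proof -
    have "a\<^sup>2 \<le> v\<^sup>2 + \<eta>\<^sup>2"
      using that assms power_mono[of a v 2] power_mono[of a \<eta> 2]
      by (auto intro: add_increasing add_increasing2)
    then have "a\<^sup>2 * \<eta>\<^sup>2 \<le> (v\<^sup>2 + \<eta>\<^sup>2) * \<eta>\<^sup>2" by (rule mult_right_mono) simp
    then show ?thesis
      using assms(2) by (simp add: pos_le_divide_eq algebra_simps flip: power_add)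
  qed
  consider "2 * a \<le> v" | "v < 2 * a" "v - 2 * a + \<eta> \<le> 0" | "v < 2 * a" "0 < v - 2 * a + \<eta>"
    by linarith
  then show ?thesis
  proof cases
    case 1
    have "(max 0 (v - 2 * a + \<eta>))\<^sup>2 \<le> (v - 2 * a + \<eta>)\<^sup>2"
      by (simp add: max_def)
    also have "\<dots> = (v - 2 * a)\<^sup>2 + 2 * ((v - 2 * a) * \<eta>) + \<eta>\<^sup>2"
      by (simp add: power2_eq_square algebra_simps)
    finally show ?thesis
      using 1 remainder assms(2) by simp
  next
    case 2
    then show ?thesis by (simp add: max_def)
  next
    case 3
    then have "(max 0 (v - 2 * a + \<eta>))\<^sup>2 \<le> \<eta>\<^sup>2"
      by (intro power_mono) auto
    also have "\<dots> \<le> (v\<^sup>2 * \<eta>\<^sup>2 + \<eta> ^ 4) / a\<^sup>2"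
      using 3 by (intro remainder) linarith
    finally show ?thesis using 3(1) by simp
  qed
qed

locale lindley_process = prob_space M for M :: "'w measure" +
  fixes V \<eta> :: "nat \<Rightarrow> 'w \<Rightarrow> real" and c D :: real
  assumes V_measurable [measurable]: "\<And>n. V n \<in> borel_measurable M"
    and \<eta>_measurable [measurable]: "\<And>n. \<eta> n \<in> borel_measurable M"
    and V_nonneg: "\<And>n \<omega>. 0 \<le> V n \<omega>"
    and V_Suc: "\<And>n \<omega>. V (Suc n) \<omega> \<le> max 0 (V n \<omega> + \<eta> n \<omega> - c)"
    and integrable_V_0_squared: "integrable M (\<lambda>\<omega>. (V 0 \<omega>)\<^sup>2)"
    and indep: "\<And>n. indep_var borel (V n) borel (\<eta> n)"
    and integrable_\<eta>_power4: "\<And>n. integrable M (\<lambda>\<omega>. \<eta> n \<omega> ^ 4)"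
    and expectation_\<eta>_power4_le: "\<And>n. expectation (\<lambda>\<omega>. \<eta> n \<omega> ^ 4) \<le> D"
    and expectation_\<eta>_nonpos: "\<And>n. expectation (\<eta> n) \<le> 0"
    and c_pos: "0 < c" and c_ge: "16 * (1 + D) \<le> c\<^sup>2"
begin

lemma integrable_\<eta>: "integrable M (\<eta> n)"
  and integrable_\<eta>_squared: "integrable M (\<lambda>\<omega>. (\<eta> n \<omega>)\<^sup>2)"
  and expectation_\<eta>_squared_le: "expectation (\<lambda>\<omega>. (\<eta> n \<omega>)\<^sup>2) \<le> 1 + D"
proof -
  show square: "integrable M (\<lambda>\<omega>. (\<eta> n \<omega>)\<^sup>2)"
    using integrable_power_le(1)[of "\<eta> n" 4 2] integrable_\<eta>_power4[of n] by simp
  show "integrable M (\<eta> n)"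
    by (rule square_integrable_imp_integrable[OF _ square]) simp
  show "expectation (\<lambda>\<omega>. (\<eta> n \<omega>)\<^sup>2) \<le> 1 + D"
    using integrable_power_le(2)[of "\<eta> n" 4 2] integrable_\<eta>_power4[of n]
      expectation_\<eta>_power4_le[of n] by simp
qed

lemma integrable_V_squared: "integrable M (\<lambda>\<omega>. (V n \<omega>)\<^sup>2)"
proof (induction n)
  case (Suc n)
  have majorant: "integrable M (\<lambda>\<omega>. 2 * (V n \<omega>)\<^sup>2 + 2 * (\<eta> n \<omega>)\<^sup>2)"
    using Suc integrable_\<eta>_squared by simp
  have "(V (Suc n) \<omega>)\<^sup>2 \<le> 2 * (V n \<omega>)\<^sup>2 + 2 * (\<eta> n \<omega>)\<^sup>2" for \<omega>
  proof -
    have "V (Suc n) \<omega> \<le> V n \<omega> + \<bar>\<eta> n \<omega>\<bar>"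
      using V_Suc[of n \<omega>] V_nonneg[of n \<omega>] c_pos by linarith
    then have "(V (Suc n) \<omega>)\<^sup>2 \<le> (V n \<omega> + \<bar>\<eta> n \<omega>\<bar>)\<^sup>2"
      using V_nonneg by (intro power_mono) auto
    also have "\<dots> \<le> 2 * (V n \<omega>)\<^sup>2 + 2 * (\<eta> n \<omega>)\<^sup>2"
      using sum_squares_bound[of "V n \<omega>" "\<bar>\<eta> n \<omega>\<bar>"] by (simp add: power2_sum)
    finally show ?thesis .
  qed
  then show ?case
    by (intro Bochner_Integration.integrable_bound[OF majorant]) auto
qed (rule integrable_V_0_squared)

definition shifted_moment :: "nat \<Rightarrow> nat \<Rightarrow> real" where
  "shifted_moment n j = expectation (\<lambda>\<omega>. (max 0 (V n \<omega> - c * real j))\<^sup>2)"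

lemma square_shift_le: "(max 0 (V n \<omega> - c * real j))\<^sup>2 \<le> (V n \<omega>)\<^sup>2"
  using V_nonneg[of n \<omega>] c_pos by (intro power_mono) auto

lemma integrable_square_shift: "integrable M (\<lambda>\<omega>. (max 0 (V n \<omega> - c * real j))\<^sup>2)"
  by (rule Bochner_Integration.integrable_bound[OF integrable_V_squared[of n]])
    (use square_shift_le in auto)

lemma shifted_moment_le: "shifted_moment n j \<le> expectation (\<lambda>\<omega>. (V n \<omega>)\<^sup>2)"
  unfolding shifted_moment_def
  by (rule integral_mono[OF integrable_square_shift integrable_V_squared square_shift_le])

lemma square_shift_Suc_le:
  "(max 0 (V (Suc n) \<omega> - c * real j))\<^sup>2
    \<le> (max 0 (V n \<omega> - c * real (Suc j)))\<^sup>2 + 2 * (max 0 (V n \<omega> - c * real (Suc j)) * \<eta> n \<omega>)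
      + ((V n \<omega>)\<^sup>2 * (\<eta> n \<omega>)\<^sup>2 + \<eta> n \<omega> ^ 4) / (c * real (Suc j) / 2)\<^sup>2"
proof -
  define a where "a = c * real (Suc j) / 2"
  have a: "2 * a = c * real (Suc j)" "0 < a"
    using c_pos by (simp_all add: a_def)
  have "0 \<le> c * real j" using c_pos by simp
  then have "max 0 (V (Suc n) \<omega> - c * real j) \<le> max 0 (V n \<omega> - c * real (Suc j) + \<eta> n \<omega>)"
    using V_Suc[of n \<omega>] by (simp add: distrib_left)
  then have "(max 0 (V (Suc n) \<omega> - c * real j))\<^sup>2 \<le> (max 0 (V n \<omega> - 2 * a + \<eta> n \<omega>))\<^sup>2"
    unfolding a by (rule power_mono) simp
  also note lindley_step_le[OF V_nonneg a(2)]
  finally show ?thesis unfolding a(1) unfolding a_def .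
qed

lemma
  assumes "0 \<le> b"
  shows integrable_shift_times_\<eta>: "integrable M (\<lambda>\<omega>. max 0 (V n \<omega> - b) * \<eta> n \<omega>)"
    and expectation_shift_times_\<eta>_nonpos: "expectation (\<lambda>\<omega>. max 0 (V n \<omega> - b) * \<eta> n \<omega>) \<le> 0"
proof -
  have "integrable M (V n)"
    by (rule square_integrable_imp_integrable[OF _ integrable_V_squared]) simp
  then have shift: "integrable M (\<lambda>\<omega>. max 0 (V n \<omega> - b))"
    by (rule Bochner_Integration.integrable_bound) (use V_nonneg assms in \<open>auto simp: max_def\<close>)
  have indep': "indep_var borel (\<lambda>\<omega>. max 0 (V n \<omega> - b)) borel (\<eta> n)"
    using indep_var_compose[OF indep[of n], of "\<lambda>v. max 0 (v - b)" borel id borel]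
    by (simp add: o_def id_def)
  show "integrable M (\<lambda>\<omega>. max 0 (V n \<omega> - b) * \<eta> n \<omega>)"
    by (rule indep_var_integrable[OF indep' shift integrable_\<eta>])
  have "0 \<le> expectation (\<lambda>\<omega>. max 0 (V n \<omega> - b))"
    by (rule Bochner_Integration.integral_nonneg) simp
  then show "expectation (\<lambda>\<omega>. max 0 (V n \<omega> - b) * \<eta> n \<omega>) \<le> 0"
    using indep_var_lebesgue_integral[OF indep' shift integrable_\<eta>] expectation_\<eta>_nonpos[of n]
    by (simp add: mult_nonneg_nonpos)
qed

lemma integrable_V_squared_times_\<eta>_squared:
    "integrable M (\<lambda>\<omega>. (V n \<omega>)\<^sup>2 * (\<eta> n \<omega>)\<^sup>2)"
  and expectation_V_squared_times_\<eta>_squared_le: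
    "expectation (\<lambda>\<omega>. (V n \<omega>)\<^sup>2 * (\<eta> n \<omega>)\<^sup>2) \<le> expectation (\<lambda>\<omega>. (V n \<omega>)\<^sup>2) * (1 + D)"
proof -
  have indep': "indep_var borel (\<lambda>\<omega>. (V n \<omega>)\<^sup>2) borel (\<lambda>\<omega>. (\<eta> n \<omega>)\<^sup>2)"
    using indep_var_compose[OF indep[of n], of "\<lambda>v. v\<^sup>2" borel "\<lambda>x. x\<^sup>2" borel]
    by (simp add: o_def)
  show "integrable M (\<lambda>\<omega>. (V n \<omega>)\<^sup>2 * (\<eta> n \<omega>)\<^sup>2)"
    by (rule indep_var_integrable[OF indep' integrable_V_squared integrable_\<eta>_squared])
  show "expectation (\<lambda>\<omega>. (V n \<omega>)\<^sup>2 * (\<eta> n \<omega>)\<^sup>2) \<le> expectation (\<lambda>\<omega>. (V n \<omega>)\<^sup>2) * (1 + D)"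
    unfolding indep_var_lebesgue_integral[OF indep' integrable_V_squared integrable_\<eta>_squared]
    by (intro mult_left_mono expectation_\<eta>_squared_le) simp
qed

text \<open>Looking back in time, the drift \<open>c\<close> is absorbed by increasing the shift, so that the shifted
  moments only grow by a summable amount per step.\<close>

lemma shifted_moment_Suc_le:
  assumes K: "expectation (\<lambda>\<omega>. (V n \<omega>)\<^sup>2) \<le> K"
  shows "shifted_moment (Suc n) j \<le> shifted_moment n (Suc j) + (1 + K) / 4 * (1 / (real (Suc j))\<^sup>2)"
proof -
  define a where "a = c * real (Suc j) / 2"
  define z where "z \<omega> = max 0 (V n \<omega> - c * real (Suc j))" for \<omega>
  have z: "integrable M (\<lambda>\<omega>. (z \<omega>)\<^sup>2)" "integrable M (\<lambda>\<omega>. z \<omega> * \<eta> n \<omega>)"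
      "expectation (\<lambda>\<omega>. z \<omega> * \<eta> n \<omega>) \<le> 0"
    unfolding z_def using c_pos integrable_square_shift[of n "Suc j"]
      integrable_shift_times_\<eta>[of "c * real (Suc j)" n]
      expectation_shift_times_\<eta>_nonpos[of "c * real (Suc j)" n] by simp_all
  have "0 \<le> expectation (\<lambda>\<omega>. (V n \<omega>)\<^sup>2)" "0 \<le> expectation (\<lambda>\<omega>. (\<eta> n \<omega>)\<^sup>2)" by simp_all
  then have nonneg: "0 \<le> K" "0 \<le> 1 + D" using K expectation_\<eta>_squared_le[of n] by linarith+
  have "shifted_moment (Suc n) j
      \<le> expectation (\<lambda>\<omega>. (z \<omega>)\<^sup>2 + 2 * (z \<omega> * \<eta> n \<omega>) + ((V n \<omega>)\<^sup>2 * (\<eta> n \<omega>)\<^sup>2 + \<eta> n \<omega> ^ 4) / a\<^sup>2)"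
    unfolding shifted_moment_def
    using integrable_square_shift z integrable_V_squared_times_\<eta>_squared integrable_\<eta>_power4
      square_shift_Suc_le
    by (intro integral_mono) (auto simp: z_def a_def)
  also have "\<dots> = shifted_moment n (Suc j) + 2 * expectation (\<lambda>\<omega>. z \<omega> * \<eta> n \<omega>)
      + (expectation (\<lambda>\<omega>. (V n \<omega>)\<^sup>2 * (\<eta> n \<omega>)\<^sup>2) + expectation (\<lambda>\<omega>. \<eta> n \<omega> ^ 4)) / a\<^sup>2"
    using z integrable_V_squared_times_\<eta>_squared integrable_\<eta>_power4
    by (simp add: shifted_moment_def z_def[abs_def])
  also have "\<dots> \<le> shifted_moment n (Suc j) + 0 + (K * (1 + D) + D) / a\<^sup>2"
    using z(3) expectation_V_squared_times_\<eta>_squared_le[of n] mult_right_mono[OF K nonneg(2)]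
      expectation_\<eta>_power4_le[of n]
    by (intro add_mono divide_right_mono) auto
  also have "(K * (1 + D) + D) / a\<^sup>2 \<le> ((1 + K) * c\<^sup>2 / 16) / a\<^sup>2"
  proof (rule divide_right_mono)
    show "K * (1 + D) + D \<le> (1 + K) * c\<^sup>2 / 16"
      using mult_left_mono[OF c_ge, of "1 + K"] nonneg(1) by (simp add: algebra_simps)
  qed simp
  also have "((1 + K) * c\<^sup>2 / 16) / a\<^sup>2 = (1 + K) / 4 * (1 / (real (Suc j))\<^sup>2)"
    using c_pos by (simp add: a_def power_divide power_mult_distrib)
  finally show ?thesis by simp
qed

proposition expectation_V_squared_le:
  "expectation (\<lambda>\<omega>. (V n \<omega>)\<^sup>2) \<le> 2 * expectation (\<lambda>\<omega>. (V 0 \<omega>)\<^sup>2) + 1" (is "_ \<le> ?K")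
proof (induction n rule: less_induct)
  case (less n)
  have "shifted_moment n 0 \<le> shifted_moment (n - i) i + (1 + ?K) / 4 * (\<Sum>j<i. 1 / (real (Suc j))\<^sup>2)"
    if "i \<le> n" for i
    using that
  proof (induction i)
    case (Suc i)
    then have "shifted_moment (n - i) i
        \<le> shifted_moment (n - Suc i) (Suc i) + (1 + ?K) / 4 * (1 / (real (Suc i))\<^sup>2)"
      using shifted_moment_Suc_le[OF less[of "n - Suc i"], of i] by (simp add: Suc_diff_Suc)
    then show ?case using Suc by (simp add: distrib_left)
  qed simp
  from this[of n] have "shifted_moment n 0
      \<le> shifted_moment 0 n + (1 + ?K) / 4 * (\<Sum>j<n. 1 / (real (Suc j))\<^sup>2)"
    by simp
  also have "\<dots> \<le> expectation (\<lambda>\<omega>. (V 0 \<omega>)\<^sup>2) + (1 + ?K) / 4 * 2"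
    by (intro add_mono mult_left_mono shifted_moment_le sum_inverse_squares_le) simp
  finally show ?case
    using V_nonneg by (simp add: shifted_moment_def max_absorb2 field_simps)
qed

end

lemma power4_diff_le: "(x - y) ^ 4 \<le> x ^ 4 + y ^ 4" if "0 \<le> x" "0 \<le> y" for x y :: real
proof -
  have "\<bar>x - y\<bar> ^ 4 \<le> max x y ^ 4" using that by (intro power_mono) auto
  then show ?thesis
    by (auto simp: max_def split: if_splits intro: add_increasing add_increasing2)
qed

lemma lindley_drift_sufficient:
  fixes \<rho> r :: real
  assumes \<rho>: "1 \<le> \<rho>" and r: "7 * \<rho>\<^sup>2 \<le> r"
  shows "0 < r - \<rho>" "16 * (\<rho> + \<rho> ^ 4) \<le> (r - \<rho>)\<^sup>2"
proof -
  have "\<rho> \<le> \<rho>\<^sup>2" "\<rho> \<le> \<rho> ^ 4" using \<rho> self_le_power[of \<rho>] by auto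
  then have drift: "6 * \<rho>\<^sup>2 \<le> r - \<rho>" using r by linarith
  have "0 < \<rho>\<^sup>2" using \<rho> by simp
  with drift show "0 < r - \<rho>" by linarith
  have "16 * (\<rho> + \<rho> ^ 4) \<le> (6 * \<rho>\<^sup>2)\<^sup>2"
    using \<rho> \<open>\<rho> \<le> \<rho> ^ 4\<close> by (simp add: power_mult_distrib flip: power_mult)
  also have "\<dots> \<le> (r - \<rho>)\<^sup>2" using drift by (intro power_mono) auto
  finally show "16 * (\<rho> + \<rho> ^ 4) \<le> (r - \<rho>)\<^sup>2" .
qed

text \<open>The previous bound applies to \<open>\<eta> = \<xi> - (1 + D)\<close>, since \<open>E \<xi> \<le> 1 + E (\<xi> ^ 4)\<close>.\<close>

proposition (in prob_space) bounded_moments_of_nonneg_lindley_recursion: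
  fixes V \<xi> :: "nat \<Rightarrow> 'a \<Rightarrow> real"
  assumes V [measurable]: "\<And>n. V n \<in> borel_measurable M"
    and \<xi> [measurable]: "\<And>n. \<xi> n \<in> borel_measurable M"
    and V_nonneg: "\<And>n \<omega>. 0 \<le> V n \<omega>" and \<xi>_nonneg: "\<And>n \<omega>. 0 \<le> \<xi> n \<omega>"
    and V_Suc: "\<And>n \<omega>. V (Suc n) \<omega> \<le> max 0 (V n \<omega> + \<xi> n \<omega> - r)"
    and integrable_V_0_squared: "integrable M (\<lambda>\<omega>. (V 0 \<omega>)\<^sup>2)"
    and indep: "\<And>n. indep_var borel (V n) borel (\<xi> n)"
    and integrable_\<xi>_power4: "\<And>n. integrable M (\<lambda>\<omega>. \<xi> n \<omega> ^ 4)"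
    and expectation_\<xi>_power4_le: "\<And>n. expectation (\<lambda>\<omega>. \<xi> n \<omega> ^ 4) \<le> D"
    and r: "7 * (1 + D)\<^sup>2 \<le> r"
  shows "bounded_moments 2 M V"
proof -
  define \<rho> where "\<rho> = 1 + D"
  define \<eta> where "\<eta> n \<omega> = \<xi> n \<omega> - \<rho>" for n \<omega>
  have "0 \<le> expectation (\<lambda>\<omega>. \<xi> 0 \<omega> ^ 4)" by simp
  then have "0 \<le> D" using expectation_\<xi>_power4_le[of 0] by linarith
  then have \<rho>: "0 \<le> \<rho>" "1 \<le> \<rho>" by (simp_all add: \<rho>_def)
  have majorant: "integrable M (\<lambda>\<omega>. \<xi> n \<omega> ^ 4 + \<rho> ^ 4)" for n
    using integrable_\<xi>_power4 by simp
  have integrable_\<eta>_power4: "integrable M (\<lambda>\<omega>. \<eta> n \<omega> ^ 4)" for n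
    unfolding \<eta>_def
    by (rule Bochner_Integration.integrable_bound[OF majorant])
      (use power4_diff_le[OF \<xi>_nonneg \<rho>(1)] in auto)
  interpret lindley_process M V \<eta> "r - \<rho>" "D + \<rho> ^ 4"
  proof unfold_locales
    show "\<eta> n \<in> borel_measurable M" for n unfolding \<eta>_def by measurable
    show "V (Suc n) \<omega> \<le> max 0 (V n \<omega> + \<eta> n \<omega> - (r - \<rho>))" for n \<omega>
      using V_Suc[of n \<omega>] by (simp add: \<eta>_def)
    show "indep_var borel (V n) borel (\<eta> n)" for n
      using indep_var_compose[OF indep[of n], of id borel "\<lambda>x. x - \<rho>" borel]
      by (simp add: o_def \<eta>_def[abs_def] id_def)
    show "expectation (\<lambda>\<omega>. \<eta> n \<omega> ^ 4) \<le> D + \<rho> ^ 4" for n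
      using integral_mono[OF integrable_\<eta>_power4[of n] majorant[of n]]
        power4_diff_le[OF \<xi>_nonneg \<rho>(1)] integrable_\<xi>_power4[of n] expectation_\<xi>_power4_le[of n]
      by (simp add: \<eta>_def prob_space)
    show "expectation (\<eta> n) \<le> 0" for n
      using integrable_power_le[of "\<xi> n" 4 1] \<xi>_nonneg integrable_\<xi>_power4[of n]
        expectation_\<xi>_power4_le[of n]
      by (simp add: \<eta>_def[abs_def] \<rho>_def prob_space)
    show "0 < r - \<rho>" "16 * (1 + (D + \<rho> ^ 4)) \<le> (r - \<rho>)\<^sup>2"
      using lindley_drift_sufficient[OF \<rho>(2), of r] r by (simp_all add: \<rho>_def add.assoc)
  qed (fact V V_nonneg integrable_V_0_squared integrable_\<eta>_power4)+
  show ?thesis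
    using integrable_V_squared expectation_V_squared_le V_nonneg by (intro bounded_momentsI) auto
qed

section \<open>The sampled closed loop\<close>

lemma cl_hist_eq_cl_state:
  "i \<le> t \<Longrightarrow> cl_hist A B k pol w x t i = cl_state A B k pol w x (t - i)"
proof (induction t arbitrary: i)
  case (Suc t)
  then show ?case
  proof (cases i)
    case 0
    then show ?thesis by (simp add: cl_state_def)
  qed simp
qed (simp add: cl_state_def)

lemma cl_hist_cong:
  "(\<And>s. s < t \<Longrightarrow> w s = w' s) \<Longrightarrow> cl_hist A B k pol w x t = cl_hist A B k pol w' x t"
  by (induction t) auto

lemma borel_measurable_matrix_vector [measurable]:
  "(*v) A \<in> borel_measurable (borel :: (real^'n) measure)" for A :: "real^'n^'m"
  by (intro borel_measurable_continuous_onI linear_continuous_on) simp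

lemma measurable_cl_hist:
  fixes A :: "real^'d^'d" and B :: "real^'m^'d"
  assumes pol [measurable]: "\<And>t. pol t \<in> borel_measurable (PiM {..<k} (\<lambda>_. borel))"
    and "\<And>s. s < t \<Longrightarrow> W s \<in> borel_measurable N"
  shows "(\<lambda>\<omega>. cl_hist A B k pol (\<lambda>s. W s \<omega>) x t i) \<in> borel_measurable N"
  using assms(2)
proof (induction t arbitrary: i)
  case (Suc t)
  have [measurable]: "W t \<in> borel_measurable N" using Suc.prems by simp
  have [measurable]: "(\<lambda>\<omega>. cl_hist A B k pol (\<lambda>s. W s \<omega>) x t j) \<in> borel_measurable N" for j
    using Suc by simp
  have [measurable]: "(\<lambda>\<omega>. restrict (cl_hist A B k pol (\<lambda>s. W s \<omega>) x t) {..<k})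
      \<in> measurable N (PiM {..<k} (\<lambda>_. borel))"
    by (rule measurable_restrict) measurable
  show ?case
    unfolding cl_hist.simps by (cases "i = 0") simp_all
qed simp

definition sampled_policy :: "nat \<Rightarrow> (nat \<Rightarrow> 'a \<Rightarrow> 'b) \<Rightarrow> nat \<Rightarrow> (nat \<Rightarrow> 'a) \<Rightarrow> 'b" where
  "sampled_policy k \<phi> t h = \<phi> (t mod k) (h (t mod k))"

lemma measurable_sampled_policy:
  assumes [measurable]: "\<And>i. \<phi> i \<in> borel_measurable borel" and "0 < k"
  shows "sampled_policy k \<phi> t \<in> borel_measurable (PiM {..<k} (\<lambda>_. borel))"
proof -
  have [measurable]: "(\<lambda>h. h (t mod k)) \<in> borel_measurable (PiM {..<k} (\<lambda>_. borel))"
    using assms(2) by (intro measurable_component_singleton) simp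
  show ?thesis unfolding sampled_policy_def[abs_def] by measurable
qed

lemma cl_state_0 [simp]: "cl_state A B k pol w x 0 = x"
  by (simp add: cl_state_def)

lemma cl_state_sampled_policy_Suc:
  assumes "0 < k"
  shows "cl_state A B k (sampled_policy k \<phi>) w x (Suc t)
    = A *v cl_state A B k (sampled_policy k \<phi>) w x t
      + B *v \<phi> (t mod k) (cl_state A B k (sampled_policy k \<phi>) w x (k * (t div k))) + w t"
  using assms cl_hist_eq_cl_state[of "t mod k" t A B k "sampled_policy k \<phi>" w x]
  by (simp add: cl_state_def sampled_policy_def minus_mod_eq_mult_div)

lemma cl_state_sampled_policy_block:
  fixes A :: "real^'d^'d"
  assumes "0 < k" "j \<le> k"
  shows "cl_state A B k (sampled_policy k \<phi>) w x (k * n + j)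
    = ((*v) A ^^ j) (cl_state A B k (sampled_policy k \<phi>) w x (k * n))
      + response ((*v) A)
          (\<lambda>i. B *v \<phi> i (cl_state A B k (sampled_policy k \<phi>) w x (k * n)) + w (k * n + i)) j"
  using assms(2)
proof (induction j)
  case (Suc j)
  then show ?case
    using cl_state_sampled_policy_Suc[OF assms(1), of A B \<phi> w x "k * n + j"]
    by (simp add: matrix_vector_right_distrib add.assoc)
qed simp

definition block_noise :: "real \<Rightarrow> nat \<Rightarrow> (nat \<Rightarrow> 'v::real_normed_vector) \<Rightarrow> nat \<Rightarrow> real" where
  "block_noise L k w n = L * (\<Sum>i<k. norm (w (k * n + i)))"

lemma bounded_moments_block_noise:
  assumes "bounded_moments p M w" "0 < p"
  shows "bounded_moments p M (\<lambda>n \<omega>. block_noise L k (\<lambda>s. w s \<omega>) n)"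
proof -
  have "bounded_moments p M (\<lambda>n \<omega>. norm (w (k * n + i) \<omega>))" for i
    by (rule bounded_moments_norm[OF bounded_moments_reindex[OF assms(1)]])
  then have "bounded_moments p M (\<lambda>n \<omega>. L *\<^sub>R (\<Sum>i<k. norm (w (k * n + i) \<omega>)))"
    using assms(2) by (intro bounded_moments_scale bounded_moments_sum)
  then show ?thesis by (simp add: block_noise_def)
qed

locale sampled_loop = block_steering "(*v) A" L "(*v) B" k F C
  for A :: "real^'d^'d" and L :: real and B :: "real^'m^'d" and k :: nat
    and F :: "nat \<Rightarrow> real^'d \<Rightarrow> real^'m" and C :: real +
  fixes r :: real
  assumes k_pos: "0 < k" and r_pos: "0 < r"
begin

abbreviation policy :: "nat \<Rightarrow> (nat \<Rightarrow> real^'d) \<Rightarrow> real^'m" where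
  "policy \<equiv> sampled_policy k (saturated_control r)"

abbreviation state :: "(nat \<Rightarrow> real^'d) \<Rightarrow> real^'d \<Rightarrow> nat \<Rightarrow> real^'d" where
  "state \<equiv> cl_state A B k policy"

lemmas state_Suc = cl_state_sampled_policy_Suc[OF k_pos, of A B "saturated_control r"]
  and state_block = cl_state_sampled_policy_block[OF k_pos, of _ A B "saturated_control r"]

lemma measurable_policy: "policy t \<in> borel_measurable (PiM {..<k} (\<lambda>_. borel))"
  by (intro measurable_sampled_policy borel_measurable_continuous_onI
      continuous_on_saturated_control r_pos k_pos)

lemma norm_policy_le: "norm (policy t h) \<le> C * r"
proof -
  have "norm (policy t h) \<le> C * min r (limit_norm (h (t mod k)))"
    using k_pos by (simp add: sampled_policy_def norm_saturated_control_le r_pos)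
  also have "\<dots> \<le> C * r" by (intro mult_left_mono C_nonneg) simp
  finally show ?thesis .
qed

definition control_gain :: real where
  "control_gain = onorm ((*v) B) * C"

lemma control_gain_nonneg: "0 \<le> control_gain"
  by (simp add: control_gain_def onorm_pos_le C_nonneg)

lemma norm_control_effect_le:
  assumes "i < k"
  shows "norm (B *v saturated_control r i y) \<le> control_gain * min r (limit_norm y)"
proof -
  have "norm (B *v saturated_control r i y) \<le> onorm ((*v) B) * norm (saturated_control r i y)"
    by (rule onorm) simp
  also have "\<dots> \<le> onorm ((*v) B) * (C * min r (limit_norm y))"
    by (intro mult_left_mono norm_saturated_control_le r_pos assms onorm_pos_le) simp
  finally show ?thesis by (simp add: control_gain_def mult.assoc)
qed

lemma norm_control_effect_le_r:
  assumes "i < k"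
  shows "norm (B *v saturated_control r i y) \<le> control_gain * r"
  using norm_control_effect_le[OF assms, of y]
  by (rule order_trans) (intro mult_left_mono control_gain_nonneg, simp)

end

section \<open>Stability of the noiseless loop\<close>

lemma asymp_stable_originI:
  assumes "0 < \<eta>" and bound: "\<And>x t. norm x < \<eta> \<Longrightarrow> norm (traj x t) \<le> D * norm x"
    and limit: "\<And>x. norm x < \<eta> \<Longrightarrow> traj x \<longlonglongrightarrow> 0"
  shows "asymp_stable_origin traj"
  unfolding asymp_stable_origin_def
proof (intro conjI allI impI)
  fix e :: real assume "0 < e"
  define \<delta> where "\<delta> = min \<eta> (e / (\<bar>D\<bar> + 1))"
  have "0 < \<delta>" using \<open>0 < \<eta>\<close> \<open>0 < e\<close> by (simp add: \<delta>_def)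
  moreover have "norm (traj x t) < e" if "norm x < \<delta>" for x t
  proof -
    have "norm (traj x t) \<le> D * norm x" using that by (intro bound) (simp add: \<delta>_def)
    also have "\<dots> \<le> (\<bar>D\<bar> + 1) * norm x" by (intro mult_right_mono) auto
    also have "\<dots> < e" using that by (simp add: \<delta>_def field_simps)
    finally show ?thesis .
  qed
  ultimately show "\<exists>\<delta>>0. \<forall>x. norm x < \<delta> \<longrightarrow> (\<forall>t. norm (traj x t) < e)" by blast
qed (use \<open>0 < \<eta>\<close> limit in blast)

context sampled_loop
begin

lemma noiseless_block_of_null:
  assumes "limit_norm (state (\<lambda>_. 0) x (k * n)) = 0" "j \<le> k"
  shows "state (\<lambda>_. 0) x (k * n + j) = ((*v) A ^^ j) (state (\<lambda>_. 0) x (k * n))"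
proof -
  have "response ((*v) A) (\<lambda>i. B *v saturated_control r i (state (\<lambda>_. 0) x (k * n)) + 0) j
      = response ((*v) A) (\<lambda>_. 0) j"
    using norm_control_effect_le[of _ "state (\<lambda>_. 0) x (k * n)"] assms r_pos
    by (intro response_cong) simp
  then show ?thesis
    by (simp add: state_block[OF assms(2)] response_zero[OF linear])
qed

lemma noiseless_after_null:
  assumes "limit_norm (state (\<lambda>_. 0) x (k * m)) = 0"
  shows "state (\<lambda>_. 0) x (k * m + n) = ((*v) A ^^ n) (state (\<lambda>_. 0) x (k * m))"
proof -
  have blocks: "state (\<lambda>_. 0) x (k * (m + l)) = ((*v) A ^^ (k * l)) (state (\<lambda>_. 0) x (k * m))" for l
  proof (induction l)
    case (Suc l)
    then have "limit_norm (state (\<lambda>_. 0) x (k * (m + l))) = 0" using assms by simp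
    from noiseless_block_of_null[OF this order_refl]
    have "state (\<lambda>_. 0) x (k * (m + Suc l))
        = ((*v) A ^^ k) (((*v) A ^^ (k * l)) (state (\<lambda>_. 0) x (k * m)))"
      unfolding Suc by (simp add: algebra_simps)
    then show ?case by (simp add: funpow_add)
  qed simp
  have "limit_norm (state (\<lambda>_. 0) x (k * (m + n div k))) = 0" "n mod k \<le> k"
    using assms k_pos by (simp_all add: blocks)
  from noiseless_block_of_null[OF this]
  have "state (\<lambda>_. 0) x (k * (m + n div k) + n mod k)
      = ((*v) A ^^ (n mod k)) (((*v) A ^^ (k * (n div k))) (state (\<lambda>_. 0) x (k * m)))"
    by (simp only: blocks)
  also have "\<dots> = ((*v) A ^^ (n mod k + k * (n div k))) (state (\<lambda>_. 0) x (k * m))"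
    by (simp only: funpow_add o_apply)
  finally show ?thesis by (simp add: distrib_left add.assoc)
qed

lemma limit_norm_noiseless_first_block:
  assumes "limit_norm x \<le> r"
  shows "limit_norm (state (\<lambda>_. 0) x k) = 0"
proof -
  have "limit_norm (state (\<lambda>_. 0) x k) \<le> max (limit_norm x - r) 0"
    using limit_norm_saturated_block_le[OF r_pos, of x]
      state_block[OF order_refl, of "\<lambda>_. 0" x 0] by simp
  then show ?thesis
    using assms limit.nonneg[of "state (\<lambda>_. 0) x k"] by simp
qed

definition first_block_gain :: real where
  "first_block_gain = L + L * (k * (control_gain * L))"

lemma norm_noiseless_first_block_le:
  assumes "t \<le> k"
  shows "norm (state (\<lambda>_. 0) x t) \<le> first_block_gain * norm x"
proof -
  have effect: "norm (B *v saturated_control r i x) \<le> control_gain * (L * norm x)" if "i < k" for i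
  proof -
    have "control_gain * min r (limit_norm x) \<le> control_gain * (L * norm x)"
      using limit_norm_le[of x] by (intro mult_left_mono control_gain_nonneg) simp
    then show ?thesis using norm_control_effect_le[OF that, of x] by linarith
  qed
  have "(\<Sum>i<t. norm (B *v saturated_control r i x)) \<le> (\<Sum>i<k. norm (B *v saturated_control r i x))"
    using assms by (intro sum_mono2) auto
  also have "\<dots> \<le> k * (control_gain * (L * norm x))"
    using sum_bounded_above[of "{..<k}" "\<lambda>i. norm (B *v saturated_control r i x)"] effect by simp
  finally have "L * (\<Sum>i<t. norm (B *v saturated_control r i x))
      \<le> L * (k * (control_gain * (L * norm x)))"
    using L_ge_1 by (intro mult_left_mono) auto
  then have "norm (response ((*v) A) (\<lambda>i. B *v saturated_control r i x) t)
      \<le> L * (k * (control_gain * (L * norm x)))"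
    by (rule order_trans[OF norm_response_le])
  then have "norm (((*v) A ^^ t) x + response ((*v) A) (\<lambda>i. B *v saturated_control r i x) t)
      \<le> L * norm x + L * (k * (control_gain * (L * norm x)))"
    by (rule norm_triangle_mono[OF norm_funpow_le])
  then show ?thesis
    using state_block[OF assms, of "\<lambda>_. 0" x 0]
    by (simp add: first_block_gain_def distrib_right mult.assoc)
qed

lemma norm_noiseless_le:
  assumes "limit_norm x \<le> r"
  shows "norm (state (\<lambda>_. 0) x t) \<le> (L * first_block_gain) * norm x"
proof (cases "t \<le> k")
  case True
  have "1 * norm (state (\<lambda>_. 0) x t) \<le> L * (first_block_gain * norm x)"
    using L_ge_1 norm_noiseless_first_block_le[OF True] by (intro mult_mono) auto
  then show ?thesis by (simp add: mult.assoc)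
next
  case False
  then have "state (\<lambda>_. 0) x t = ((*v) A ^^ (t - k)) (state (\<lambda>_. 0) x k)"
    using noiseless_after_null[of x 1 "t - k"] limit_norm_noiseless_first_block[OF assms] by simp
  then have "norm (state (\<lambda>_. 0) x t) \<le> L * norm (state (\<lambda>_. 0) x k)"
    using norm_funpow_le by simp
  also have "\<dots> \<le> L * (first_block_gain * norm x)"
    using L_ge_1 norm_noiseless_first_block_le[of k] by (intro mult_left_mono) auto
  finally show ?thesis by (simp add: mult.assoc)
qed

proposition asymp_stable_noiseless: "asymp_stable_origin (state (\<lambda>_. 0))"
proof (rule asymp_stable_originI)
  have small: "limit_norm x \<le> r" if "norm x < r / L" for x
    using limit_norm_le[of x] that L_ge_1 by (simp add: field_simps)
  show "0 < r / L" using r_pos L_ge_1 by simp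
  show "norm (state (\<lambda>_. 0) x t) \<le> (L * first_block_gain) * norm x" if "norm x < r / L" for x t
    by (rule norm_noiseless_le[OF small[OF that]])
  show "state (\<lambda>_. 0) x \<longlonglongrightarrow> 0" if "norm x < r / L" for x
  proof (rule LIMSEQ_offset[where k = k])
    note null = limit_norm_noiseless_first_block[OF small[OF that]]
    then show "(\<lambda>n. state (\<lambda>_. 0) x (n + k)) \<longlonglongrightarrow> 0"
      using noiseless_after_null[of x 1] by (simp add: limit_norm_eq_0_iff add.commute[of _ k])
  qed
qed

end

section \<open>Second moments of the closed loop\<close>

context sampled_loop
begin

definition excess :: "(nat \<Rightarrow> real^'d) \<Rightarrow> real^'d \<Rightarrow> nat \<Rightarrow> real" where
  "excess w x n = max 0 (limit_norm (state w x (k * n)) - r)"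

lemma excess_nonneg: "0 \<le> excess w x n"
  by (simp add: excess_def)

lemma block_noise_nonneg: "0 \<le> block_noise L k w n"
  using L_ge_1 by (simp add: block_noise_def sum_nonneg)

lemma limit_norm_block_le:
  fixes w x n
  defines "y \<equiv> state w x (k * n)"
  assumes j: "j \<le> k"
  shows "limit_norm (state w x (k * n + j))
    \<le> limit_norm (((*v) A ^^ j) y + response ((*v) A) (\<lambda>i. B *v saturated_control r i y) j)
      + block_noise L k w n"
proof -
  have "limit_norm (response ((*v) A) (\<lambda>i. w (k * n + i)) j) \<le> (\<Sum>i<j. limit_norm (w (k * n + i)))"
    by (rule limit_norm_response_le)
  also have "\<dots> \<le> (\<Sum>i<k. limit_norm (w (k * n + i)))"
    using j by (intro sum_mono2) auto
  also have "\<dots> \<le> (\<Sum>i<k. L * norm (w (k * n + i)))"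
    by (intro sum_mono limit_norm_le)
  finally have "limit_norm (response ((*v) A) (\<lambda>i. w (k * n + i)) j) \<le> block_noise L k w n"
    by (simp add: block_noise_def sum_distrib_left)
  then show ?thesis
    unfolding state_block[OF j] response_add[OF linear] y_def[symmetric] add.assoc[symmetric]
    by (intro order_trans[OF limit.triangle] add_left_mono)
qed

lemma excess_Suc_le: "excess w x (Suc n) \<le> max 0 (excess w x n + block_noise L k w n - r)"
proof -
  have "limit_norm (state w x (k * n + k)) \<le> excess w x n + block_noise L k w n"
    using limit_norm_block_le[OF order_refl, of w x n]
      limit_norm_saturated_block_le[OF r_pos, of "state w x (k * n)"]
    by (simp add: excess_def max.commute)
  then show ?thesis by (simp add: excess_def[of w x "Suc n"] add.commute)
qed

lemma limit_norm_state_le: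
  "limit_norm (state w x t) \<le> excess w x (t div k) + block_noise L k w (t div k)
    + (r + k * (L * (control_gain * r)))"
proof -
  define n j y where "n = t div k" and "j = t mod k" and "y = state w x (k * n)"
  have j: "j < k" and t: "t = k * n + j"
    using k_pos by (simp_all add: n_def j_def)
  have effect: "limit_norm (B *v saturated_control r i y) \<le> L * (control_gain * r)" if "i < k" for i
    using L_ge_1 norm_control_effect_le_r[OF that]
    by (intro order_trans[OF limit_norm_le mult_left_mono]) auto
  define z where "z = ((*v) A ^^ j) y + response ((*v) A) (\<lambda>i. B *v saturated_control r i y) j"
  have "limit_norm z
      \<le> limit_norm y + (\<Sum>i<j. limit_norm (B *v saturated_control r i y))"
    unfolding z_def by (rule order_trans[OF limit.triangle]) (simp add: limit_norm_response_le)
  also have "\<dots> \<le> limit_norm y + (\<Sum>i<k. limit_norm (B *v saturated_control r i y))"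
    using j by (intro add_left_mono sum_mono2) auto
  also have "\<dots> \<le> limit_norm y + k * (L * (control_gain * r))"
    using sum_bounded_above[of "{..<k}" "\<lambda>i. limit_norm (B *v saturated_control r i y)"] effect
    by simp
  also have "limit_norm y \<le> excess w x n + r"
    by (simp add: excess_def y_def)
  finally have "limit_norm z \<le> excess w x n + r + k * (L * (control_gain * r))" by simp
  moreover have "limit_norm (state w x t) \<le> limit_norm z + block_noise L k w n"
    using limit_norm_block_le[of j w x n] j by (simp add: z_def y_def flip: t)
  ultimately show ?thesis unfolding n_def by linarith
qed

lemma measurable_limit_norm [measurable]: "limit_norm \<in> borel_measurable borel"
  by (rule borel_measurable_continuous_onI[OF limit.continuous_on])

lemma measurable_state:
  assumes "\<And>s. s < t \<Longrightarrow> w s \<in> borel_measurable N"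
  shows "(\<lambda>\<omega>. state (\<lambda>s. w s \<omega>) x t) \<in> borel_measurable N"
  unfolding cl_state_def using measurable_policy assms by (rule measurable_cl_hist)

lemma indep_excess_block_noise:
  fixes w :: "nat \<Rightarrow> 'w \<Rightarrow> real^'d"
  assumes M: "prob_space M" and indep: "prob_space.indep_vars M (\<lambda>_. borel) w UNIV"
  shows "prob_space.indep_var M borel (\<lambda>\<omega>. excess (\<lambda>s. w s \<omega>) x n)
    borel (\<lambda>\<omega>. block_noise L k (\<lambda>s. w s \<omega>) n)"
proof -
  interpret prob_space M by (fact M)
  define past where "past = {..<k * n}"
  define current where "current = {k * n..<k * n + k}"
  have "indep_var (PiM past (\<lambda>_. borel)) (\<lambda>\<omega>. \<lambda>s\<in>past. w s \<omega>)
      (PiM current (\<lambda>_. borel)) (\<lambda>\<omega>. \<lambda>s\<in>current. w s \<omega>)"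
    by (rule indep_var_restrict[OF indep]) (auto simp: past_def current_def)
  moreover have "(\<lambda>h. excess h x n) \<in> borel_measurable (PiM past (\<lambda>_. borel))"
  proof -
    have [measurable]: "(\<lambda>h. state (\<lambda>s. h s) x (k * n)) \<in> borel_measurable (PiM past (\<lambda>_. borel))"
      by (rule measurable_state) (simp add: past_def)
    show ?thesis unfolding excess_def by measurable
  qed
  moreover have "(\<lambda>h. block_noise L k h n)
      \<in> borel_measurable (PiM current (\<lambda>_. borel :: (real^'d) measure))"
  proof -
    have [measurable]: "(\<lambda>h. h (k * n + i))
        \<in> borel_measurable (PiM current (\<lambda>_. borel :: (real^'d) measure))"
      if "i \<in> {..<k}" for i
      using that by (intro measurable_component_singleton) (simp add: current_def)
    show ?thesis unfolding block_noise_def by measurable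
  qed
  ultimately have "indep_var borel ((\<lambda>h. excess h x n) \<circ> (\<lambda>\<omega>. \<lambda>s\<in>past. w s \<omega>))
      borel ((\<lambda>h. block_noise L k h n) \<circ> (\<lambda>\<omega>. \<lambda>s\<in>current. w s \<omega>))"
    by (rule indep_var_compose)
  moreover have "excess (\<lambda>s\<in>past. w s \<omega>) x n = excess (\<lambda>s. w s \<omega>) x n" for \<omega>
  proof -
    have "cl_hist A B k policy (\<lambda>s\<in>past. w s \<omega>) x (k * n)
        = cl_hist A B k policy (\<lambda>s. w s \<omega>) x (k * n)"
      by (rule cl_hist_cong) (simp add: past_def)
    then show ?thesis by (simp only: excess_def cl_state_def)
  qed
  moreover have "block_noise L k (\<lambda>s\<in>current. w s \<omega>) n = block_noise L k (\<lambda>s. w s \<omega>) n" for \<omega>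
    by (simp add: block_noise_def current_def)
  ultimately show ?thesis by (simp add: o_def)
qed

end

locale noisy_sampled_loop = sampled_loop A L B k F C r + prob_space M
  for A :: "real^'d^'d" and L :: real and B :: "real^'m^'d" and k :: nat
    and F :: "nat \<Rightarrow> real^'d \<Rightarrow> real^'m" and C r :: real and M :: "'w measure" +
  fixes w :: "nat \<Rightarrow> 'w \<Rightarrow> real^'d" and D :: real
  assumes indep_w: "indep_vars (\<lambda>_. borel) w UNIV"
    and moments_w: "bounded_moments 4 M w"
    and expectation_block_noise_power4_le: "expectation (\<lambda>\<omega>. block_noise L k (\<lambda>s. w s \<omega>) n ^ 4) \<le> D"
    and r_ge: "7 * (1 + D)\<^sup>2 \<le> r"
begin

lemma measurable_w [measurable]: "w t \<in> borel_measurable M"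
  using moments_w by (rule bounded_momentsD_measurable)

lemma measurable_noisy_state [measurable]: "(\<lambda>\<omega>. state (\<lambda>s. w s \<omega>) x t) \<in> borel_measurable M"
  by (rule measurable_state) measurable

lemma bounded_moments_noise: "bounded_moments 4 M (\<lambda>n \<omega>. block_noise L k (\<lambda>s. w s \<omega>) n)"
  using moments_w by (rule bounded_moments_block_noise) simp

lemma bounded_moments_excess: "bounded_moments 2 M (\<lambda>n \<omega>. excess (\<lambda>s. w s \<omega>) x n)"
proof (rule bounded_moments_of_nonneg_lindley_recursion[where V = "\<lambda>n \<omega>. excess (\<lambda>s. w s \<omega>) x n",
      OF _ _ _ _ excess_Suc_le _ indep_excess_block_noise[OF prob_space_axioms indep_w] _
        expectation_block_noise_power4_le r_ge])
  show "(\<lambda>\<omega>. excess (\<lambda>s. w s \<omega>) x n) \<in> borel_measurable M" for n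
    unfolding excess_def by measurable
  show "(\<lambda>\<omega>. block_noise L k (\<lambda>s. w s \<omega>) n) \<in> borel_measurable M" for n
    using bounded_moments_noise by (rule bounded_momentsD_measurable)
  show "integrable M (\<lambda>\<omega>. block_noise L k (\<lambda>s. w s \<omega>) n ^ 4)" for n
    using bounded_moments_noise by (rule bounded_momentsE) simp
qed (simp_all add: excess_nonneg block_noise_nonneg excess_def)

lemma bounded_moments_limit_norm: "bounded_moments 2 M (\<lambda>t \<omega>. limit_norm (state (\<lambda>s. w s \<omega>) x t))"
proof (rule bounded_moments_mono)
  show "bounded_moments 2 M (\<lambda>t \<omega>. excess (\<lambda>s. w s \<omega>) x (t div k)
      + block_noise L k (\<lambda>s. w s \<omega>) (t div k) + (r + k * (L * (control_gain * r))))"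
    using bounded_moments_excess bounded_moments_noise[THEN bounded_moments_le]
    by (intro bounded_moments_add bounded_moments_const
        bounded_moments_reindex[where h = "\<lambda>t. t div k"]) auto
  show "norm (limit_norm (state (\<lambda>s. w s \<omega>) x t)) \<le> norm (excess (\<lambda>s. w s \<omega>) x (t div k)
      + block_noise L k (\<lambda>s. w s \<omega>) (t div k) + (r + k * (L * (control_gain * r))))" for t \<omega>
    using limit_norm_state_le[of "\<lambda>s. w s \<omega>" x t] by simp
qed measurable

proposition bounded_moments_state: "bounded_moments 2 M (\<lambda>t \<omega>. state (\<lambda>s. w s \<omega>) x t)"
proof -
  obtain q \<theta> E where q: "seminorm q" "\<And>x. norm x \<le> q x" and \<theta>: "0 < \<theta>" "\<theta> < 1" and "0 \<le> E"
    and contraction: "\<And>x. q (A *v x) \<le> \<theta> * q x + E * limit_norm x"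
    by (rule adapted_norm_exists) blast
  interpret q: euclidean_seminorm q using q(1) by (simp add: euclidean_seminorm_def)
  define Q where "Q = (\<Sum>b\<in>Basis. q b)"
  have [measurable]: "q \<in> borel_measurable borel"
    by (rule borel_measurable_continuous_onI[OF q.continuous_on])
  have q_Suc_le: "q (state v x (Suc t))
      \<le> \<theta> * q (state v x t)
        + (E * limit_norm (state v x t) + Q * (control_gain * r) + Q * norm (v t))" for v t
  proof -
    define u where "u = B *v saturated_control r (t mod k) (state v x (k * (t div k)))"
    have "q u \<le> Q * (control_gain * r)"
      unfolding Q_def u_def using k_pos
      by (intro order_trans[OF q.le_norm mult_left_mono] norm_control_effect_le_r sum_nonneg) auto
    moreover have "q (state v x (Suc t)) \<le> q (A *v state v x t) + q u + q (v t)"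
      unfolding state_Suc u_def[symmetric]
      using q.triangle[of "A *v state v x t + u" "v t"] q.triangle[of "A *v state v x t" u]
      by linarith
    ultimately show ?thesis
      using contraction[of "state v x t"] q.le_norm[of "v t"] by (simp add: Q_def)
  qed
  have "bounded_moments 2 M (\<lambda>t \<omega>. E *\<^sub>R limit_norm (state (\<lambda>s. w s \<omega>) x t)
      + Q * (control_gain * r) + Q *\<^sub>R norm (w t \<omega>))"
    using bounded_moments_limit_norm moments_w[THEN bounded_moments_le]
    by (intro bounded_moments_add bounded_moments_scale bounded_moments_const bounded_moments_norm)
      auto
  then have input: "bounded_moments 2 M (\<lambda>t \<omega>. E * limit_norm (state (\<lambda>s. w s \<omega>) x t)
      + Q * (control_gain * r) + Q * norm (w t \<omega>))" by simp
  have "bounded_moments 2 M (\<lambda>t \<omega>. q (state (\<lambda>s. w s \<omega>) x t))"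
    by (rule bounded_moments_contracting_recursion[OF _ q.nonneg _ q_Suc_le input
          less_imp_le[OF \<theta>(1)] \<theta>(2)]) simp_all
  then show ?thesis
    by (rule bounded_moments_mono) (use q(2) in \<open>auto intro: order_trans\<close>)
qed

end

lemma block_steering_of_stabilizable:
  fixes A :: "real^'d^'d" and B :: "real^'m^'d"
  assumes "\<And>l. is_eigenvalue A l \<Longrightarrow> cmod l \<le> 1"
    and "\<And>l. is_eigenvalue A l \<Longrightarrow> cmod l = 1 \<Longrightarrow> alg_mult A l = geom_mult A l"
    and "stabilizable A B"
  obtains L F C where "block_steering ((*v) A) L ((*v) B) CARD('d) F C"
proof -
  obtain L where "power_bounded_map ((*v) A) L"
    using power_bounded_map_of_bounded_orbits[OF matrix_vector_mul_linear
        bounded_orbits[OF assms(1,2)]] by blast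
  then interpret controlled_map "(*v) A" L "(*v) B"
    by (simp add: controlled_map_def controlled_map_axioms_def)
  obtain K where K: "\<And>l. is_eigenvalue (A + B ** K) l \<Longrightarrow> cmod l < 1"
    using assms(3) unfolding stabilizable_def by blast
  have "(\<lambda>x. A *v x + B *v (K *v x)) = (*v) (A + B ** K)"
    by (simp add: fun_eq_iff matrix_vector_mult_add_rdistrib matrix_vector_mul_assoc)
  then have "(\<lambda>n. ((\<lambda>x. A *v x + B *v (K *v x)) ^^ n) x) \<longlonglongrightarrow> 0" for x
    using orbits_tendsto_0[of "A + B ** K" x] K by simp
  then have "reach DIM(real^'d) = UNIV"
    by (rule reach_eq_UNIV)
  then obtain F C where "block_steering ((*v) A) L ((*v) B) DIM(real^'d) F C"
    by (rule block_steering_exists)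
  then show thesis using that by simp
qed

theorem theorem1:
  fixes A :: "real^'d^'d" and B :: "real^'m^'d"
    and M :: "'w measure" and w :: "nat \<Rightarrow> 'w \<Rightarrow> real^'d" and Q :: "nat \<Rightarrow> real^'d^'d"
  assumes eig_disk: "\<And>l. is_eigenvalue A l \<Longrightarrow> cmod l \<le> 1"
    and eig_unit: "\<And>l. is_eigenvalue A l \<Longrightarrow> cmod l = 1 \<Longrightarrow> alg_mult A l = geom_mult A l"
    and stab: "stabilizable A B"
    and P: "prob_space M"
    and w_meas: "\<And>t. w t \<in> borel_measurable M"
    and w_indep: "prob_space.indep_vars M (\<lambda>_. borel) w UNIV"
    and w_int: "\<And>t. integrable M (w t)"
    and w_mean: "\<And>t. (\<integral>\<omega>. w t \<omega> \<partial>M) = 0"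
    and w_cov_int: "\<And>t. integrable M (\<lambda>\<omega>. (\<chi> i j. w t \<omega> $ i * w t \<omega> $ j) :: real^'d^'d)"
    and w_cov: "\<And>t. (\<integral>\<omega>. ((\<chi> i j. w t \<omega> $ i * w t \<omega> $ j) :: real^'d^'d) \<partial>M) = Q t"
    and w_4th: "(SUP t. \<integral>\<^sup>+ \<omega>. ennreal (norm (w t \<omega>) ^ 4) \<partial>M) < \<infinity>"
  shows "\<exists>(R::real) (k::nat) (pol :: nat \<Rightarrow> (nat \<Rightarrow> real^'d) \<Rightarrow> real^'m).
           R > 0 \<and> 1 \<le> k \<and> k \<le> CARD('d) \<and>
           (\<forall>t. pol t \<in> borel_measurable (PiM {..<k} (\<lambda>_. borel))) \<and>
           (\<forall>t. \<forall>h \<in> (\<Pi>\<^sub>E i\<in>{..<k}. UNIV). norm (pol t h) \<le> R) \<and>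
           (\<forall>x. (SUP t. \<integral>\<^sup>+ \<omega>. ennreal (norm (cl_state A B k pol (\<lambda>s. w s \<omega>) x t) ^ 2) \<partial>M)
                  < \<infinity>) \<and>
           asymp_stable_origin (\<lambda>x. cl_state A B k pol (\<lambda>_. 0) x)"
proof -
  obtain L F C where steering: "block_steering ((*v) A) L ((*v) B) CARD('d) F C"
    using eig_disk eig_unit stab by (rule block_steering_of_stabilizable)
  have w_moments: "bounded_moments 4 M w"
    using w_meas w_4th by (simp add: bounded_moments_def)
  then obtain D where D: "\<And>n. (\<integral>\<omega>. block_noise L CARD('d) (\<lambda>s. w s \<omega>) n ^ 4 \<partial>M) \<le> D"
    by (rule bounded_momentsE[OF bounded_moments_block_noise[where L = L and k = "CARD('d)"]]) auto
  define r where "r = max 1 (7 * (1 + D)\<^sup>2)"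
  have "sampled_loop A L B CARD('d) F C r"
    using steering by (simp add: sampled_loop_def sampled_loop_axioms_def r_def)
  then interpret noisy_sampled_loop A L B "CARD('d)" F C r M w D
    using P w_indep w_moments D
    by (intro noisy_sampled_loop.intro noisy_sampled_loop_axioms.intro) (simp_all add: r_def)
  have "0 < C * r + 1"
    using C_nonneg r_pos by (simp add: add_nonneg_pos)
  moreover have "norm (policy t h) \<le> C * r + 1" for t h
    using norm_policy_le[of t h] by linarith
  ultimately show ?thesis
    using measurable_policy bounded_moments_state asymp_stable_noiseless
    by (intro exI[of _ "C * r + 1"] exI[of _ "CARD('d)"] exI[of _ policy])
       (auto simp: bounded_moments_def Suc_le_eq)
qed

end
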